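(* Let $C\subset\mathbb{R}^d$ be a normal cone and let $(B_t)$ be Brownian motion with drift $a\in\mathbb{R}^d$. If $a$ belongs to $C$, then for every $x\in C$, $$\mathbb{P}_x[\tau_C=\infty]=\lim_{t\to\infty}\mathbb{P}_x[\tau_C>t]=(2\pi)^{d/2}e^{|x-a|^2/2}\,p^C(1,x,a).$$
   Context: Let $d\ge2$. $\Theta$ is a proper, open, connected subset of the unit sphere $\mathbb{S}^{d-1}$ and $C=\{\lambda\theta:\lambda>0,\theta\in\Theta\}$. The cone is normal if $\Theta$ is piecewise infinitely differentiable. $p^C(t,x,y)$ denotes the transition density of the standard Brownian motion with zero drift killed at the boundary of $C$ (the Dirichlet heat kernel of $\frac12\Delta$ on $C$). Under $\mathbb{P}_x$, $B$ starts at $x$, has drift $a$ and identity covariance matrix; $\tau_C=\inf\{t>0:B_t\notin C\}$. *)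

theory Defs
  imports "HOL-Probability.Probability"
begin

definition gauss_density :: "real ^ 'n \<Rightarrow> real \<Rightarrow> real ^ 'n \<Rightarrow> real" where
  "gauss_density m v y =
     exp (- (norm (y - m))\<^sup>2 / (2 * v)) / (2 * pi * v) powr (real CARD('n) / 2)"

text \<open>Brownian motion started at \<open>x\<close>, with drift \<open>a\<close> and identity covariance matrix, under the
  law \<open>M\<close>. Only times \<open>t \<ge> 0\<close> are meaningful. Every path is continuous, so that events about exit
  times are measurable even if \<open>M\<close> is not complete.\<close>

definition brownian_motion ::
  "'w measure \<Rightarrow> (real \<Rightarrow> 'w \<Rightarrow> real ^ 'n) \<Rightarrow> real ^ 'n \<Rightarrow> real ^ 'n \<Rightarrow> bool" where
  "brownian_motion M B x a \<longleftrightarrow>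
     prob_space M \<and>
     (\<forall>t\<ge>0. B t \<in> borel_measurable M) \<and>
     (\<forall>\<omega>\<in>space M. continuous_on {0..} (\<lambda>t. B t \<omega>)) \<and>
     (AE \<omega> in M. B 0 \<omega> = x) \<and>
     (\<forall>(t :: nat \<Rightarrow> real) n. 0 \<le> t 0 \<and> mono t \<longrightarrow>
        prob_space.indep_vars M (\<lambda>_. borel) (\<lambda>i \<omega>. B (t (Suc i)) \<omega> - B (t i) \<omega>) {..<n}) \<and>
     (\<forall>s t. 0 \<le> s \<and> s < t \<longrightarrow>
        distributed M lborel (\<lambda>\<omega>. B t \<omega> - B s \<omega>)
          (\<lambda>y. ennreal (gauss_density ((t - s) *\<^sub>R a) (t - s) y)))"

definition exit_time :: "(real ^ 'n) set \<Rightarrow> (real \<Rightarrow> real ^ 'n) \<Rightarrow> ereal" where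
  "exit_time C b = Inf (ereal ` {t. 0 < t \<and> b t \<notin> C})"

text \<open>\<open>p t x y\<close> is the transition density of the process killed on leaving \<open>C\<close>; \<open>P x\<close> is
  the law under which \<open>B\<close> starts at \<open>x\<close>. A density is only determined up to null sets; continuity
  in \<open>y\<close> singles out its values at every point of the open set \<open>C\<close>. Applied to driftless
  Brownian motion this is the Dirichlet heat kernel of half the Laplacian on \<open>C\<close>. Values of \<open>p\<close> for
  \<open>t \<le> 0\<close> or outside \<open>C\<close> are irrelevant.\<close>

definition killed_transition_density ::
  "(real ^ 'n \<Rightarrow> 'w measure) \<Rightarrow> (real \<Rightarrow> 'w \<Rightarrow> real ^ 'n) \<Rightarrow> (real ^ 'n) set \<Rightarrow>
   (real \<Rightarrow> real ^ 'n \<Rightarrow> real ^ 'n \<Rightarrow> real) \<Rightarrow> bool" where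
  "killed_transition_density P B C p \<longleftrightarrow>
     (\<forall>t>0. \<forall>x\<in>C.
        continuous_on C (p t x) \<and>
        (\<forall>y\<in>C. 0 \<le> p t x y) \<and>
        (\<forall>A\<in>sets borel. A \<subseteq> C \<longrightarrow>
           emeasure (P x) {\<omega> \<in> space (P x). B t \<omega> \<in> A \<and> ereal t < exit_time C (\<lambda>s. B s \<omega>)} =
           (\<integral>\<^sup>+ y\<in>A. ennreal (p t x y) \<partial>lborel)))"

definition partial_deriv :: "'n \<Rightarrow> (real ^ 'n \<Rightarrow> real) \<Rightarrow> real ^ 'n \<Rightarrow> real" where
  "partial_deriv i f x = frechet_derivative f (at x) (axis i 1)"

definition grad :: "(real ^ 'n \<Rightarrow> real) \<Rightarrow> real ^ 'n \<Rightarrow> real ^ 'n" where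
  "grad f x = (\<chi> i. partial_deriv i f x)"

primrec Ck_on :: "nat \<Rightarrow> (real ^ 'n) set \<Rightarrow> (real ^ 'n \<Rightarrow> real) \<Rightarrow> bool" where
  "Ck_on 0 U f \<longleftrightarrow> continuous_on U f"
| "Ck_on (Suc k) U f \<longleftrightarrow>
     (\<forall>x\<in>U. f differentiable (at x)) \<and> (\<forall>i. Ck_on k U (partial_deriv i f))"

definition smooth_on :: "(real ^ 'n) set \<Rightarrow> (real ^ 'n \<Rightarrow> real) \<Rightarrow> bool" where
  "smooth_on U f \<longleftrightarrow> (\<forall>k. Ck_on k U f)"

text \<open>A compact smooth hypersurface with corners in the unit sphere: the zero set of \<open>g\<close>, cut off
  by the inequalities \<open>h j \<ge> 0\<close>. At each of its points \<open>y\<close> the vectors \<open>y\<close> (the normal of the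
  sphere), \<open>grad g y\<close> and the gradients of those \<open>h j\<close> that vanish at \<open>y\<close> are linearly
  independent.\<close>

definition smooth_patch :: "(real ^ 'n) set \<Rightarrow> bool" where
  "smooth_patch F \<longleftrightarrow> compact F \<and>
     (\<exists>U g (m :: nat) h. open U \<and> smooth_on U g \<and> (\<forall>j<m. smooth_on U (h j)) \<and>
        F = {y \<in> sphere 0 1 \<inter> U. g y = 0 \<and> (\<forall>j<m. 0 \<le> h j y)} \<and>
        (\<forall>y\<in>F. \<forall>\<alpha> \<beta> c.
           \<alpha> *\<^sub>R y + \<beta> *\<^sub>R grad g y + (\<Sum>j\<in>{j. j < m \<and> h j y = 0}. c j *\<^sub>R grad (h j) y) = 0
             \<longrightarrow> \<alpha> = 0 \<and> \<beta> = 0 \<and> (\<forall>j<m. h j y = 0 \<longrightarrow> c j = 0)))"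

text \<open>The boundary relative to the sphere is a finite union of smooth pieces. The pieces may meet at
  arbitrary angles (edges, vertices, re-entrant corners, cusps).\<close>

definition piecewise_smooth :: "(real ^ 'n) set \<Rightarrow> bool" where
  "piecewise_smooth \<Theta> \<longleftrightarrow>
     (\<exists>\<F>. finite \<F> \<and> (\<forall>F\<in>\<F>. smooth_patch F) \<and>
        top_of_set (sphere 0 1) frontier_of \<Theta> = \<Union>\<F>)"

definition normal_cone :: "(real ^ 'n) set \<Rightarrow> bool" where
  "normal_cone C \<longleftrightarrow>
     (\<exists>\<Theta>. \<Theta> \<noteq> {} \<and> \<Theta> \<subset> sphere 0 1 \<and> openin (top_of_set (sphere 0 1)) \<Theta> \<and>
        connected \<Theta> \<and> piecewise_smooth \<Theta> \<and>
        C = {r *\<^sub>R \<theta> | r \<theta>. 0 < r \<and> \<theta> \<in> \<Theta>})"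

end

theory Submission
  imports Defs "HOL-Real_Asymp.Real_Asymp"
begin

text \<open>The theorem is an instance of time inversion of Brownian motion. Let \<open>W\<close> be Brownian motion
  from \<open>x\<close> and condition it on \<open>W 1 = y\<close>. In the new time \<open>u = s / (1 - s)\<close> the process
  \<open>(1 + u) W (u / (1 + u))\<close> is then Brownian motion from \<open>x\<close> with drift \<open>y\<close>, for all times \<open>u \<ge> 0\<close>.
  Only a positive rescaling of space is involved, so one path stays in the cone \<open>C\<close> on \<open>[0, 1)\<close> exactly
  when the other stays in \<open>C\<close> forever. Writing \<open>h y\<close> for the probability that Brownian motion
  from \<open>x\<close> with drift \<open>y\<close> never leaves \<open>C\<close>, this says
  \<open>p 1 x y = exp (- |y - x|\<^sup>2 / 2) / (2 \<pi>) powr (d / 2) * h y\<close>,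
  which at \<open>y = a\<close> is the claim.

  The conditioning only makes sense for almost every \<open>y\<close>: the identity of laws is
  \<open>bridge_law\<close>, its consequence for the kernel is \<open>killed_density_eq_confinement_AE\<close>. To reach the
  point \<open>y = a\<close> one needs that \<open>h\<close> is continuous at \<open>a\<close>, since \<open>p 1 x\<close> is continuous by assumption.

  Lower semicontinuity of \<open>h\<close> (\<open>confinement_lsc\<close>) is a statement on paths: by the law of large numbers
  a path with drift \<open>a\<close> in the open cone is eventually well inside the cone, so small changes of the
  drift only matter on a compact time interval, where the path has a positive distance from the
  complement. The law of large numbers is again a consequence of time inversion and of the
  continuity of paths at time \<open>1\<close>.

  Upper semicontinuity (\<open>exit_lsc\<close>) follows because \<open>h\<close> is the infimum over \<open>T\<close> of the
  probabilities to stay in \<open>C\<close> up to time \<open>T\<close>. By time inversion with horizon \<open>T\<close> these depend on the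
  drift only through the Gaussian density of the position at time \<open>T\<close>, hence continuously.

  The identity of laws itself is reduced to finitely many times, where it follows by induction from an
  identity between Gaussian transition densities (\<open>gauss_density_bridge\<close>).\<close>

section \<open>Gaussian densities and the Markov property\<close>

lemma brownian_motionD:
  assumes "brownian_motion M B x b"
  shows "prob_space M"
    and "\<And>t. 0 \<le> t \<Longrightarrow> B t \<in> borel_measurable M"
    and "\<And>\<omega>. \<omega> \<in> space M \<Longrightarrow> continuous_on {0..} (\<lambda>t. B t \<omega>)"
    and "AE \<omega> in M. B 0 \<omega> = x"
    and "\<And>(t :: nat \<Rightarrow> real) n. 0 \<le> t 0 \<Longrightarrow> mono t \<Longrightarrow>
        prob_space.indep_vars M (\<lambda>_. borel) (\<lambda>i \<omega>. B (t (Suc i)) \<omega> - B (t i) \<omega>) {..<n}"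
    and "\<And>s t. 0 \<le> s \<Longrightarrow> s < t \<Longrightarrow>
        distributed M lborel (\<lambda>\<omega>. B t \<omega> - B s \<omega>)
          (\<lambda>y. ennreal (gauss_density ((t - s) *\<^sub>R b) (t - s) y))"
  using assms unfolding brownian_motion_def by auto

lemma borel_measurable_gauss_density [measurable]:
  assumes [measurable]: "f \<in> borel_measurable M" "g \<in> borel_measurable M"
  shows "(\<lambda>z. gauss_density (f z) v (g z)) \<in> borel_measurable M"
  unfolding gauss_density_def by measurable

lemma gauss_density_nonneg: "0 \<le> gauss_density m v y"
  by (simp add: gauss_density_def)

lemma nn_integral_lborel_translate:
  fixes f :: "'a :: euclidean_space \<Rightarrow> ennreal"
  assumes [measurable]: "f \<in> borel_measurable borel"
  shows "(\<integral>\<^sup>+z. f (c + z) \<partial>lborel) = (\<integral>\<^sup>+z. f z \<partial>lborel)"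
  by (subst (2) lborel_distr_plus[of c, symmetric]) (simp add: nn_integral_distr)

lemma nn_integral_lborel_scale:
  fixes f :: "'a :: euclidean_space \<Rightarrow> ennreal"
  assumes [measurable]: "f \<in> borel_measurable borel" and c: "c > 0"
  shows "(\<integral>\<^sup>+z. f z \<partial>lborel) = ennreal (c ^ DIM('a)) * (\<integral>\<^sup>+z. f (c *\<^sub>R z) \<partial>lborel)"
  using c by (subst lborel_affine[of c 0])
     (simp_all add: nn_integral_density nn_integral_distr nn_integral_cmult)

lemma brownian_motion_add_drift:
  fixes B :: "real \<Rightarrow> 'w \<Rightarrow> real ^ 'n"
  assumes "brownian_motion M B x b"
  shows "brownian_motion M (\<lambda>t \<omega>. B t \<omega> + t *\<^sub>R c) x (b + c)"
proof -
  note D = brownian_motionD[OF assms]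
  interpret prob_space M by (rule D(1))
  have indep: "indep_vars (\<lambda>_. borel)
        (\<lambda>i \<omega>. B (t (Suc i)) \<omega> + t (Suc i) *\<^sub>R c - (B (t i) \<omega> + t i *\<^sub>R c)) {..<n}"
    if t: "0 \<le> t 0" "mono t" for t :: "nat \<Rightarrow> real" and n
  proof -
    have "indep_vars (\<lambda>_. borel)
        (\<lambda>i \<omega>. (B (t (Suc i)) \<omega> - B (t i) \<omega>) + (t (Suc i) - t i) *\<^sub>R c) {..<n}"
      by (rule indep_vars_compose2[OF D(5)[OF t, of n], where Y="\<lambda>i z. z + (t (Suc i) - t i) *\<^sub>R c"]) simp
    then show ?thesis by (simp add: algebra_simps)
  qed
  have dist: "distributed M lborel (\<lambda>\<omega>. B t \<omega> + t *\<^sub>R c - (B s \<omega> + s *\<^sub>R c))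
          (\<lambda>y. ennreal (gauss_density ((t - s) *\<^sub>R (b + c)) (t - s) y))"
    if st: "0 \<le> s" "s < t" for s t
  proof -
    let ?g = "\<lambda>y. ennreal (gauss_density ((t - s) *\<^sub>R b) (t - s) y)"
    let ?h = "\<lambda>y. ennreal (gauss_density ((t - s) *\<^sub>R (b + c)) (t - s) y)"
    let ?v = "(t - s) *\<^sub>R c"
    have [measurable]: "B t \<in> borel_measurable M" "B s \<in> borel_measurable M"
      using st by (auto intro!: D(2))
    have "distr M lborel (\<lambda>\<omega>. B t \<omega> + t *\<^sub>R c - (B s \<omega> + s *\<^sub>R c)) =
        distr (distr M lborel (\<lambda>\<omega>. B t \<omega> - B s \<omega>)) lborel (\<lambda>z. ?v + z)"
      by (subst distr_distr) (auto simp: o_def algebra_simps)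
    also have "distr M lborel (\<lambda>\<omega>. B t \<omega> - B s \<omega>) = density lborel ?g"
      by (rule distributed_distr_eq_density[OF D(6)[OF st]])
    also have "distr (density lborel ?g) lborel (\<lambda>z. ?v + z) = density lborel ?h"
    proof (rule measure_eqI)
      fix A :: "(real^'n) set" assume "A \<in> sets (distr (density lborel ?g) lborel (\<lambda>z. ?v + z))"
      then have [measurable]: "A \<in> sets borel" by simp
      have [measurable]: "(\<lambda>z. ?v + z) -` A \<in> sets borel"
        using measurable_sets_borel[of "\<lambda>z. ?v + z" borel A] by simp
      have "emeasure (distr (density lborel ?g) lborel (\<lambda>z. ?v + z)) A =
          (\<integral>\<^sup>+z. ?g z * indicator ((\<lambda>z. ?v + z) -` A) z \<partial>lborel)"
        by (subst emeasure_distr) (auto simp: emeasure_density)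
      then have "emeasure (distr (density lborel ?g) lborel (\<lambda>z. ?v + z)) A =
          (\<integral>\<^sup>+z. ?g z * indicator A (?v + z) \<partial>lborel)"
          by (simp only: indicator_vimage)
      also have "\<dots> = (\<integral>\<^sup>+z. ?h (?v + z) * indicator A (?v + z) \<partial>lborel)"
        by (intro nn_integral_cong) (simp add: gauss_density_def algebra_simps)
      also have "\<dots> = (\<integral>\<^sup>+z. ?h z * indicator A z \<partial>lborel)"
        by (rule nn_integral_lborel_translate) simp
      also have "\<dots> = emeasure (density lborel ?h) A"
        by (simp add: emeasure_density)
      finally show "emeasure (distr (density lborel ?g) lborel (\<lambda>z. ?v + z)) A =
        emeasure (density lborel ?h) A" .
    qed simp
    finally show ?thesis by (auto simp: distributed_def)
  qed
  show ?thesis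
    unfolding brownian_motion_def
    using D(1-4) indep dist by (auto intro!: continuous_intros)
qed

lemma (in prob_space) nn_integral_indep_var:
  assumes "indep_var S X T Y" and [measurable]: "G \<in> borel_measurable (S \<Otimes>\<^sub>M T)"
  shows "(\<integral>\<^sup>+\<omega>. G (X \<omega>, Y \<omega>) \<partial>M) = (\<integral>\<^sup>+\<omega>. \<integral>\<^sup>+\<eta>. G (X \<omega>, Y \<eta>) \<partial>M \<partial>M)"
proof -
  have [measurable]: "X \<in> measurable M S" "Y \<in> measurable M T"
    and eq: "distr M S X \<Otimes>\<^sub>M distr M T Y = distr M (S \<Otimes>\<^sub>M T) (\<lambda>x. (X x, Y x))"
    using assms(1) by (simp_all add: indep_var_distribution_eq)
  interpret Y: prob_space "distr M T Y" by (rule prob_space_distr) simp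
  have "(\<integral>\<^sup>+\<omega>. G (X \<omega>, Y \<omega>) \<partial>M) = (\<integral>\<^sup>+p. G p \<partial>distr M (S \<Otimes>\<^sub>M T) (\<lambda>x. (X x, Y x)))"
    by (subst nn_integral_distr) auto
  also have "\<dots> = (\<integral>\<^sup>+w. \<integral>\<^sup>+z. G (w, z) \<partial>distr M T Y \<partial>distr M S X)"
    by (subst eq[symmetric], subst Y.nn_integral_fst[symmetric]) (auto cong: measurable_cong_sets)
  also have "\<dots> = (\<integral>\<^sup>+\<omega>. \<integral>\<^sup>+z. G (X \<omega>, z) \<partial>distr M T Y \<partial>M)"
    by (subst nn_integral_distr) (auto cong: measurable_cong_sets)
  also have "\<dots> = (\<integral>\<^sup>+\<omega>. \<integral>\<^sup>+\<eta>. G (X \<omega>, Y \<eta>) \<partial>M \<partial>M)"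
    using measurable_space[OF \<open>X \<in> measurable M S\<close>]
    by (intro nn_integral_cong, subst nn_integral_distr) auto
  finally show ?thesis .
qed

text \<open>The Markov property in the only form used here: the last of finitely many observations is
  integrated out against the Gaussian transition density. The past increments are independent of
  the last one, and the past positions are their partial sums.\<close>

lemma brownian_motion_markov_step:
  fixes B :: "real \<Rightarrow> 'w \<Rightarrow> real ^ 'n" and t :: "nat \<Rightarrow> real"
  assumes bm: "brownian_motion M B x b"
    and t: "t 0 = 0" "strict_mono t"
    and K: "\<And>i. K i \<in> sets borel"
    and f [measurable]: "f \<in> borel_measurable borel"
  shows "(\<integral>\<^sup>+\<omega>. (\<Prod>i\<le>k. indicator (K i) (B (t i) \<omega>)) * f (B (t (Suc k)) \<omega>) \<partial>M) =
    (\<integral>\<^sup>+\<omega>. (\<Prod>i\<le>k. indicator (K i) (B (t i) \<omega>)) *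
      (\<integral>\<^sup>+z. ennreal (gauss_density ((t (Suc k) - t k) *\<^sub>R b) (t (Suc k) - t k) z) *
         f (B (t k) \<omega> + z) \<partial>lborel) \<partial>M)"
proof -
  note D = brownian_motionD[OF bm]
  note [measurable] = K
  interpret prob_space M by (rule D(1))
  have t0: "0 \<le> t i" for i using t strict_monoD[OF t(2), of 0 i] by (cases i) auto
  note [measurable] = D(2)[OF t0]
  let ?inc = "\<lambda>i \<omega>. B (t (Suc i)) \<omega> - B (t i) \<omega>"
  let ?past = "\<lambda>\<omega>. \<lambda>i\<in>{..<k}. ?inc i \<omega>"
  let ?S = "PiM {..<k} (\<lambda>_. borel :: (real^'n) measure)"
  have "indep_vars (\<lambda>_. borel) ?inc {..<Suc k}"
    using t0 t(2) by (intro D(5)) (auto dest: strict_mono_mono)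
  then have indep: "indep_var ?S ?past (PiM {k} (\<lambda>_. borel)) (\<lambda>\<omega>. \<lambda>i\<in>{k}. ?inc i \<omega>)"
    by (rule indep_var_restrict) auto
  define pos where "pos d i = x + (\<Sum>j<i. d j)" for d :: "nat \<Rightarrow> real^'n" and i
  have [measurable]: "(\<lambda>d. pos d i) \<in> borel_measurable ?S" if "i \<le> k" for i
    using that unfolding pos_def by (auto intro!: borel_measurable_add borel_measurable_sum measurable_component_singleton)
  have pos: "AE \<omega> in M. \<forall>i\<le>k. pos (?past \<omega>) i = B (t i) \<omega>"
    using D(4)
  proof eventually_elim
    case (elim \<omega>)
    have "pos (?past \<omega>) i = x + (\<Sum>j<i. ?inc j \<omega>)" if "i \<le> k" for i
      using that by (auto simp: pos_def)
    moreover have "(\<Sum>j<i. ?inc j \<omega>) = B (t i) \<omega> - B (t 0) \<omega>" for i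
      by (rule sum_lessThan_telescope)
    ultimately show ?case using elim t(1) by simp
  qed
  let ?T = "PiM {k} (\<lambda>_. borel :: (real^'n) measure)"
  let ?now = "\<lambda>\<omega>. \<lambda>i\<in>{k}. ?inc i \<omega>"
  define G where "G = (\<lambda>(d, v). (\<Prod>i\<le>k. indicator (K i) (pos d i)) * f (pos d k + v k) :: ennreal)"
  have [measurable]: "G \<in> borel_measurable (?S \<Otimes>\<^sub>M ?T)"
    unfolding G_def by measurable
  have dist: "distributed M lborel (?inc k)
      (\<lambda>z. ennreal (gauss_density ((t (Suc k) - t k) *\<^sub>R b) (t (Suc k) - t k) z))"
    using t0 t(2) by (intro D(6)) (auto simp: strict_mono_Suc_iff)
  have "(\<integral>\<^sup>+\<omega>. (\<Prod>i\<le>k. indicator (K i) (B (t i) \<omega>)) * f (B (t (Suc k)) \<omega>) \<partial>M) =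
      (\<integral>\<^sup>+\<omega>. G (?past \<omega>, ?now \<omega>) \<partial>M)"
    using pos by (intro nn_integral_cong_AE, eventually_elim) (simp add: G_def)
  also have "\<dots> = (\<integral>\<^sup>+\<omega>. \<integral>\<^sup>+\<eta>. G (?past \<omega>, ?now \<eta>) \<partial>M \<partial>M)"
    by (rule nn_integral_indep_var[OF indep]) simp
  also have "\<dots> = (\<integral>\<^sup>+\<omega>. (\<Prod>i\<le>k. indicator (K i) (B (t i) \<omega>)) *
      (\<integral>\<^sup>+z. ennreal (gauss_density ((t (Suc k) - t k) *\<^sub>R b) (t (Suc k) - t k) z) *
         f (B (t k) \<omega> + z) \<partial>lborel) \<partial>M)"
    using pos
  proof (intro nn_integral_cong_AE, eventually_elim)
    case (elim \<omega>)
    have "(\<integral>\<^sup>+\<eta>. G (?past \<omega>, ?now \<eta>) \<partial>M) =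
        (\<integral>\<^sup>+\<eta>. (\<Prod>i\<le>k. indicator (K i) (B (t i) \<omega>)) * f (B (t k) \<omega> + ?inc k \<eta>) \<partial>M)"
      using elim by (simp add: G_def)
    also have "\<dots> = (\<Prod>i\<le>k. indicator (K i) (B (t i) \<omega>)) * (\<integral>\<^sup>+\<eta>. f (B (t k) \<omega> + ?inc k \<eta>) \<partial>M)"
      by (rule nn_integral_cmult) simp
    also have "(\<integral>\<^sup>+\<eta>. f (B (t k) \<omega> + ?inc k \<eta>) \<partial>M) =
        (\<integral>\<^sup>+z. ennreal (gauss_density ((t (Suc k) - t k) *\<^sub>R b) (t (Suc k) - t k) z) *
         f (B (t k) \<omega> + z) \<partial>lborel)"
      by (rule distributed_nn_integral[OF dist, symmetric]) simp
    finally show ?case .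
  qed
  finally show ?thesis .
qed

section \<open>Time inversion of transition densities\<close>

text \<open>Completing the square for the product of two Gaussian densities with variances \<open>\<alpha>\<close> and \<open>\<beta>\<close>.\<close>

lemma norm_square_split:
  fixes p q :: "'a :: real_inner"
  assumes "\<alpha> > 0" "\<beta> > 0"
  shows "(norm p)\<^sup>2 / \<alpha> + (norm q)\<^sup>2 / \<beta> =
    (norm (p + q))\<^sup>2 / (\<alpha> + \<beta>) + (norm (\<beta> *\<^sub>R p - \<alpha> *\<^sub>R q))\<^sup>2 / (\<alpha> * \<beta> * (\<alpha> + \<beta>))"
proof -
  have nz: "\<alpha> \<noteq> 0" "\<beta> \<noteq> 0" "\<alpha> + \<beta> \<noteq> 0" using assms by auto
  show ?thesis
    unfolding power2_norm_eq_inner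
      inner_add_left inner_add_right inner_diff_left inner_diff_right inner_commute[of q p]
    using nz by (simp add: inner_diff_left inner_diff_right inner_commute[of q p] divide_simps) algebra
qed

lemma gauss_density_drift:
  assumes "v > 0"
  shows "gauss_density (v *\<^sub>R b) v z = gauss_density 0 v z * exp (b \<bullet> z - v * (norm b)\<^sup>2 / 2)"
proof -
  have "(norm (z - v *\<^sub>R b))\<^sup>2 = (norm z)\<^sup>2 - 2 * v * (b \<bullet> z) + v * v * (norm b)\<^sup>2"
    unfolding power2_norm_eq_inner
    by (simp add: inner_diff_left inner_diff_right inner_commute[of z b] algebra_simps)
  then have "- (norm (z - v *\<^sub>R b))\<^sup>2 / (2 * v) = - (norm z)\<^sup>2 / (2 * v) + (b \<bullet> z - v * (norm b)\<^sup>2 / 2)"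
    using assms by (simp only:) (simp add: diff_divide_distrib add_divide_distrib)
  then show ?thesis by (simp only: gauss_density_def exp_add diff_zero times_divide_eq_left)
qed

text \<open>The transition densities behind time inversion. Write \<open>s = u T / (u + T)\<close> and rescale space at
  that time by \<open>T / (u + T)\<close>. A step of the Brownian motion from \<open>s\<close> to \<open>s'\<close>, conditioned to be at
  \<open>y\<close> at time \<open>T\<close>, is in the new coordinates a step from \<open>u\<close> to \<open>u'\<close> of Brownian motion with drift
  \<open>y / T\<close>. The factor \<open>(T / (u' + T))\<^sup>d\<close> is the Jacobian of the rescaling. The drift \<open>b\<close>
  disappears because a bridge does not remember the drift.\<close>

lemma gauss_density_bridge:
  fixes z z' y b :: "real ^ 'n"
  assumes u: "0 \<le> u" "u < u'" and T: "0 < T"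
  defines "c \<equiv> T / (u + T)" and "c' \<equiv> T / (u' + T)"
  defines "s \<equiv> u * T / (u + T)" and "s' \<equiv> u' * T / (u' + T)"
  shows "c' ^ CARD('n) * gauss_density ((s' - s) *\<^sub>R b) (s' - s) (c' *\<^sub>R z' - c *\<^sub>R z) *
      gauss_density ((T - s') *\<^sub>R b) (T - s') (y - c' *\<^sub>R z') =
    gauss_density ((T - s) *\<^sub>R b) (T - s) (y - c *\<^sub>R z) *
      gauss_density ((u' - u) *\<^sub>R (y /\<^sub>R T)) (u' - u) (z' - z)"
proof -
  define \<alpha> where "\<alpha> = s' - s"
  define \<beta> where "\<beta> = T - s'"
  define p where "p = c' *\<^sub>R z' - c *\<^sub>R z"
  define q where "q = y - c' *\<^sub>R z'"
  define d where "d = u' - u"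
  define w where "w = z' - z - d *\<^sub>R (y /\<^sub>R T)"
  have pos: "u + T > 0" "u' + T > 0" "d > 0" "c > 0" "c' > 0" using u T by (auto simp: d_def c_def c'_def)
  have \<alpha>: "\<alpha> = c * c' * d" 
    using pos(1,2) T by (simp add: \<alpha>_def s_def s'_def c_def c'_def d_def divide_simps) algebra
  have \<beta>: "\<beta> = T * c'" using pos(1,2) by (simp add: \<beta>_def s'_def c'_def divide_simps) algebra
  have \<alpha>\<beta>: "\<alpha> + \<beta> = T * c" using pos(1,2) by (simp add: \<alpha>_def \<beta>_def s_def c_def divide_simps) algebra
  have \<alpha>0: "\<alpha> > 0" and \<beta>0: "\<beta> > 0" using pos T by (auto simp: \<alpha> \<beta>)
  have r: "\<beta> *\<^sub>R p - \<alpha> *\<^sub>R q = (T * c * c') *\<^sub>R w"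
  proof -
    have "\<beta> *\<^sub>R p - \<alpha> *\<^sub>R q = ((\<alpha> + \<beta>) * c') *\<^sub>R z' - (\<beta> * c) *\<^sub>R z - \<alpha> *\<^sub>R y"
      by (simp add: p_def q_def algebra_simps)
    moreover have "(\<alpha> + \<beta>) * c' = T * c * c'" by (simp only: \<alpha>\<beta>)
    moreover have "\<beta> * c = T * c * c'" by (simp add: \<beta>)
    moreover have "\<alpha> = T * c * c' * (d / T)" using \<alpha> T by simp
    ultimately have "\<beta> *\<^sub>R p - \<alpha> *\<^sub>R q =
        (T * c * c') *\<^sub>R z' - (T * c * c') *\<^sub>R z - (T * c * c' * (d / T)) *\<^sub>R y"
      by metis
    then show ?thesis by (simp only: w_def scaleR_diff_right scaleR_scaleR divide_inverse mult.assoc)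
  qed
  have expo: "(norm p)\<^sup>2 / \<alpha> + (norm q)\<^sup>2 / \<beta> = (norm (p + q))\<^sup>2 / (\<alpha> + \<beta>) + (norm w)\<^sup>2 / d"
  proof -
    have "\<alpha> * \<beta> * (\<alpha> + \<beta>) = (T * c * c')\<^sup>2 * d"
      unfolding \<alpha>\<beta> unfolding \<alpha> \<beta> by algebra
    then have "(norm (\<beta> *\<^sub>R p - \<alpha> *\<^sub>R q))\<^sup>2 / (\<alpha> * \<beta> * (\<alpha> + \<beta>)) = (norm w)\<^sup>2 / d"
      using T pos by (simp only: r norm_scaleR power_mult_distrib power2_abs) simp
    then show ?thesis using norm_square_split[OF \<alpha>0 \<beta>0, of p q] by (simp only:)
  qed
  have norming: "(2 * pi * \<alpha>) powr (real CARD('n) / 2) * (2 * pi * \<beta>) powr (real CARD('n) / 2) =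
    c' ^ CARD('n) * ((2 * pi * (\<alpha> + \<beta>)) powr (real CARD('n) / 2) * (2 * pi * d) powr (real CARD('n) / 2))"
  proof -
    have "c' ^ CARD('n) = (c'\<^sup>2) powr (real CARD('n) / 2)"
    proof -
      have "c'\<^sup>2 = c' powr 2" using pos by simp
      then have "(c'\<^sup>2) powr (real CARD('n) / 2) = c' powr real CARD('n)" by (simp add: powr_powr)
      then show ?thesis using pos(5) by (simp add: powr_realpow)
    qed
    moreover have "(2 * pi * \<alpha>) * (2 * pi * \<beta>) = c'\<^sup>2 * ((2 * pi * (\<alpha> + \<beta>)) * (2 * pi * d))"
      unfolding \<alpha>\<beta> unfolding \<alpha> \<beta> by algebra
    then have "(2 * pi * \<alpha>) powr (real CARD('n) / 2) * (2 * pi * \<beta>) powr (real CARD('n) / 2) =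
        (c'\<^sup>2) powr (real CARD('n) / 2) *
        ((2 * pi * (\<alpha> + \<beta>)) powr (real CARD('n) / 2) * (2 * pi * d) powr (real CARD('n) / 2))"
      by (metis powr_mult)
    ultimately show ?thesis by simp
  qed
  \<comment> \<open>The identity without drift; the drift only multiplies both sides by the same exponential.\<close>
  have base: "c' ^ CARD('n) * gauss_density 0 \<alpha> p * gauss_density 0 \<beta> q =
      gauss_density 0 (\<alpha> + \<beta>) (p + q) * gauss_density 0 d w"
  proof -
    have "exp (- (norm p)\<^sup>2 / (2 * \<alpha>)) * exp (- (norm q)\<^sup>2 / (2 * \<beta>)) =
        exp (- ((norm p)\<^sup>2 / \<alpha> + (norm q)\<^sup>2 / \<beta>) / 2)"
      unfolding mult_exp_exp by (simp add: diff_divide_distrib mult.commute)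
    also have "\<dots> = exp (- (norm (p + q))\<^sup>2 / (2 * (\<alpha> + \<beta>))) * exp (- (norm w)\<^sup>2 / (2 * d))"
      unfolding expo mult_exp_exp by (simp add: diff_divide_distrib mult.commute)
    finally have "exp (- (norm p)\<^sup>2 / (2 * \<alpha>)) * exp (- (norm q)\<^sup>2 / (2 * \<beta>)) =
        exp (- (norm (p + q))\<^sup>2 / (2 * (\<alpha> + \<beta>))) * exp (- (norm w)\<^sup>2 / (2 * d))" .
    moreover have "(2 * pi * v) powr (real CARD('n) / 2) \<noteq> 0" if "v > 0" for v
      using that by simp
    moreover have "k * (e1 / n1) * (e2 / n2) = (e3 / n3) * (e4 / n4)"
      if "n1 \<noteq> 0" "n2 \<noteq> 0" "n3 \<noteq> 0" "n4 \<noteq> 0" "n1 * n2 = k * (n3 * n4)" "e1 * e2 = e3 * e4"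
      for k n1 n2 n3 n4 e1 e2 e3 e4 :: real
    proof -
      have "k * (e1 / n1) * (e2 / n2) = k * (e1 * e2) / (n1 * n2)" by simp
      also have "\<dots> = (e3 * e4) / (n3 * n4)" using that by (cases "k = 0") auto
      finally show ?thesis by simp
    qed
    moreover have "\<alpha> + \<beta> > 0" using \<alpha>0 \<beta>0 by simp
    ultimately show ?thesis
      using norming \<alpha>0 \<beta>0 pos(3) unfolding gauss_density_def diff_zero by blast
  qed
  have "c' ^ CARD('n) * gauss_density (\<alpha> *\<^sub>R b) \<alpha> p * gauss_density (\<beta> *\<^sub>R b) \<beta> q =
      gauss_density ((\<alpha> + \<beta>) *\<^sub>R b) (\<alpha> + \<beta>) (p + q) * gauss_density 0 d w"
  proof -
    have "exp (b \<bullet> p - \<alpha> * (norm b)\<^sup>2 / 2) * exp (b \<bullet> q - \<beta> * (norm b)\<^sup>2 / 2) =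
        exp (b \<bullet> (p + q) - (\<alpha> + \<beta>) * (norm b)\<^sup>2 / 2)"
      unfolding mult_exp_exp by (simp add: inner_add_right algebra_simps add_divide_distrib)
    moreover have "k * (g1 * e1) * (g2 * e2) = (g3 * e3) * g4"
      if "k * g1 * g2 = g3 * g4" "e1 * e2 = e3" for k g1 g2 g3 g4 e1 e2 e3 :: real
    proof -
      have "k * (g1 * e1) * (g2 * e2) = (k * g1 * g2) * (e1 * e2)" by simp
      also have "\<dots> = g3 * g4 * e3" by (simp only: that)
      finally show ?thesis by simp
    qed
    moreover have "\<alpha> + \<beta> > 0" using \<alpha>0 \<beta>0 by simp
    ultimately show ?thesis
      using base unfolding gauss_density_drift[OF \<alpha>0] gauss_density_drift[OF \<beta>0]
        gauss_density_drift[OF \<open>\<alpha> + \<beta> > 0\<close>] by blast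
  qed
  moreover have "p + q = y - c *\<^sub>R z" by (simp add: p_def q_def)
  moreover have "\<alpha> + \<beta> = T - s" by (simp add: \<alpha>_def \<beta>_def)
  moreover have "gauss_density 0 d w = gauss_density (d *\<^sub>R (y /\<^sub>R T)) d (z' - z)"
    by (simp add: w_def gauss_density_def)
  ultimately show ?thesis by (simp only: \<alpha>_def \<beta>_def p_def q_def d_def)
qed

text \<open>One grid point of the time inversion: the position at time \<open>s'\<close> is integrated out on the left, the
  corresponding increment of the inverted process on the right. The density identity is applied
  under the integral sign after the substitution \<open>z \<mapsto> w + z\<close>, a rescaling, and an exchange of the
  order of integration.\<close>

lemma bridge_step:
  fixes w b :: "real ^ 'n" and \<psi> :: "(real ^ 'n) \<times> (real ^ 'n) \<Rightarrow> ennreal"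
  assumes u: "0 \<le> u" "u < u'" and T: "0 < T"
    and [measurable]: "\<psi> \<in> borel_measurable (borel \<Otimes>\<^sub>M borel)"
  defines "r \<equiv> (u + T) / T" and "r' \<equiv> (u' + T) / T"
  defines "s \<equiv> u * T / (u + T)" and "s' \<equiv> u' * T / (u' + T)"
  shows "(\<integral>\<^sup>+z. ennreal (gauss_density ((s' - s) *\<^sub>R b) (s' - s) z) *
        (\<integral>\<^sup>+y. ennreal (gauss_density ((T - s') *\<^sub>R b) (T - s') (y - (w + z))) * \<psi> (r' *\<^sub>R (w + z), y) \<partial>lborel) \<partial>lborel) =
    (\<integral>\<^sup>+y. ennreal (gauss_density ((T - s) *\<^sub>R b) (T - s) (y - w)) *
        (\<integral>\<^sup>+z. ennreal (gauss_density ((u' - u) *\<^sub>R (y /\<^sub>R T)) (u' - u) z) * \<psi> (r *\<^sub>R w + z, y) \<partial>lborel) \<partial>lborel)"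
proof -
  define c' where "c' = T / (u' + T)"
  define q1 where "q1 = gauss_density ((s' - s) *\<^sub>R b) (s' - s)"
  define q2 where "q2 = gauss_density ((T - s') *\<^sub>R b) (T - s')"
  define q3 where "q3 = gauss_density ((T - s) *\<^sub>R b) (T - s)"
  define q4 where "q4 y = gauss_density ((u' - u) *\<^sub>R (y /\<^sub>R T)) (u' - u)" for y :: "real^'n"
  have nn: "0 \<le> q1 z" "0 \<le> q2 z" "0 \<le> q3 z" "0 \<le> q4 y z" for y z
    by (simp_all add: q1_def q2_def q3_def q4_def gauss_density_nonneg)
  have [measurable]: "q1 \<in> borel_measurable borel" "q2 \<in> borel_measurable borel" "q3 \<in> borel_measurable borel"
    "(\<lambda>p. q4 (fst p) (snd p)) \<in> borel_measurable (borel \<Otimes>\<^sub>M borel)"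
    by (simp_all add: q1_def q2_def q3_def q4_def)
  have [measurable]: "(\<lambda>x. q4 (f x) (g x)) \<in> borel_measurable L"
    if [measurable]: "f \<in> borel_measurable L" "g \<in> borel_measurable L" for f g and L :: "'c measure"
    by (simp add: q4_def)
  have c': "c' > 0" "r' * c' = 1" using u T by (auto simp: c'_def r'_def)
  have wr: "w = (T / (u + T)) *\<^sub>R (r *\<^sub>R w)" using u T by (simp add: r_def)
  have bridge: "c' ^ CARD('n) * q1 (c' *\<^sub>R z - w) * q2 (y - c' *\<^sub>R z) = q3 (y - w) * q4 y (z - r *\<^sub>R w)" for y z
    using gauss_density_bridge[OF u T, of b z "r *\<^sub>R w" y] wr
    unfolding q1_def q2_def q3_def q4_def c'_def s_def s'_def by simp
  define G where "G w' = ennreal (q1 (w' - w)) * (\<integral>\<^sup>+y. ennreal (q2 (y - w')) * \<psi> (r' *\<^sub>R w', y) \<partial>lborel)" for w'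
  have [measurable]: "G \<in> borel_measurable borel"
    unfolding G_def by measurable
  have "(\<integral>\<^sup>+z. ennreal (q1 z) * (\<integral>\<^sup>+y. ennreal (q2 (y - (w + z))) * \<psi> (r' *\<^sub>R (w + z), y) \<partial>lborel) \<partial>lborel) =
      (\<integral>\<^sup>+z. G (w + z) \<partial>lborel)"
    by (simp add: G_def)
  also have "\<dots> = (\<integral>\<^sup>+w'. G w' \<partial>lborel)"
    by (rule nn_integral_lborel_translate) simp
  also have "\<dots> = ennreal (c' ^ CARD('n)) * (\<integral>\<^sup>+z. G (c' *\<^sub>R z) \<partial>lborel)"
    using nn_integral_lborel_scale[of G c'] c' by simp
  also have "\<dots> = (\<integral>\<^sup>+z. ennreal (c' ^ CARD('n)) * G (c' *\<^sub>R z) \<partial>lborel)"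
    by (rule nn_integral_cmult[symmetric]) simp
  also have "\<dots> = (\<integral>\<^sup>+z. \<integral>\<^sup>+y. ennreal (q3 (y - w)) * (ennreal (q4 y (z - r *\<^sub>R w)) * \<psi> (z, y)) \<partial>lborel \<partial>lborel)"
  proof (intro nn_integral_cong)
    fix z
    have "ennreal (c' ^ CARD('n)) * G (c' *\<^sub>R z) = ennreal (c' ^ CARD('n)) * ennreal (q1 (c' *\<^sub>R z - w)) *
        (\<integral>\<^sup>+y. ennreal (q2 (y - c' *\<^sub>R z)) * \<psi> (z, y) \<partial>lborel)"
      using c' by (simp add: G_def mult.assoc)
    also have "\<dots> = (\<integral>\<^sup>+y. ennreal (c' ^ CARD('n)) * ennreal (q1 (c' *\<^sub>R z - w)) *
        (ennreal (q2 (y - c' *\<^sub>R z)) * \<psi> (z, y)) \<partial>lborel)"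
      by (rule nn_integral_cmult[symmetric]) simp
    also have "\<dots> = (\<integral>\<^sup>+y. ennreal (q3 (y - w)) * (ennreal (q4 y (z - r *\<^sub>R w)) * \<psi> (z, y)) \<partial>lborel)"
    proof (intro nn_integral_cong)
      fix y
      have "ennreal (c' ^ CARD('n)) * ennreal (q1 (c' *\<^sub>R z - w)) * ennreal (q2 (y - c' *\<^sub>R z)) =
          ennreal (q3 (y - w)) * ennreal (q4 y (z - r *\<^sub>R w))"
        using bridge[of z y] c'(1) nn by (simp add: ennreal_mult[symmetric])
      then show "ennreal (c' ^ CARD('n)) * ennreal (q1 (c' *\<^sub>R z - w)) * (ennreal (q2 (y - c' *\<^sub>R z)) * \<psi> (z, y)) =
          ennreal (q3 (y - w)) * (ennreal (q4 y (z - r *\<^sub>R w)) * \<psi> (z, y))"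
        by (simp only: mult.assoc[symmetric])
    qed
    finally show "ennreal (c' ^ CARD('n)) * G (c' *\<^sub>R z) =
      (\<integral>\<^sup>+y. ennreal (q3 (y - w)) * (ennreal (q4 y (z - r *\<^sub>R w)) * \<psi> (z, y)) \<partial>lborel)" .
  qed
  also have "\<dots> = (\<integral>\<^sup>+y. \<integral>\<^sup>+z. ennreal (q3 (y - w)) * (ennreal (q4 y (z - r *\<^sub>R w)) * \<psi> (z, y)) \<partial>lborel \<partial>lborel)"
    by (rule lborel_pair.Fubini') measurable
  also have "\<dots> = (\<integral>\<^sup>+y. ennreal (q3 (y - w)) * (\<integral>\<^sup>+z. ennreal (q4 y z) * \<psi> (r *\<^sub>R w + z, y) \<partial>lborel) \<partial>lborel)"
  proof (intro nn_integral_cong)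
    fix y
    have "(\<integral>\<^sup>+z. ennreal (q3 (y - w)) * (ennreal (q4 y (z - r *\<^sub>R w)) * \<psi> (z, y)) \<partial>lborel) =
        ennreal (q3 (y - w)) * (\<integral>\<^sup>+z. ennreal (q4 y (z - r *\<^sub>R w)) * \<psi> (z, y) \<partial>lborel)"
      by (rule nn_integral_cmult) simp
    also have "(\<integral>\<^sup>+z. ennreal (q4 y (z - r *\<^sub>R w)) * \<psi> (z, y) \<partial>lborel) =
        (\<integral>\<^sup>+z. ennreal (q4 y (r *\<^sub>R w + z - r *\<^sub>R w)) * \<psi> (r *\<^sub>R w + z, y) \<partial>lborel)"
      by (rule nn_integral_lborel_translate[symmetric]) simp
    finally show "(\<integral>\<^sup>+z. ennreal (q3 (y - w)) * (ennreal (q4 y (z - r *\<^sub>R w)) * \<psi> (z, y)) \<partial>lborel) =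
        ennreal (q3 (y - w)) * (\<integral>\<^sup>+z. ennreal (q4 y z) * \<psi> (r *\<^sub>R w + z, y) \<partial>lborel)"
      by simp
  qed
  finally show ?thesis by (simp only: q1_def q2_def q3_def q4_def)
qed

lemma strict_mono_bridge_time:
  fixes u :: "nat \<Rightarrow> real"
  assumes u: "strict_mono u" "\<And>i. 0 \<le> u i" and T: "0 < T"
  shows "strict_mono (\<lambda>i. u i * T / (u i + T))"
  unfolding strict_mono_Suc_iff
proof
  fix i
  have "u i < u (Suc i)" using u(1) by (simp add: strict_mono_Suc_iff)
  then show "u i * T / (u i + T) < u (Suc i) * T / (u (Suc i) + T)"
    using u(2)[of i] u(2)[of "Suc i"] T by (simp add: divide_simps algebra_simps)
qed

text \<open>Finite-dimensional form of the time inversion, by induction on the number of grid points. The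
  observable \<open>\<phi>\<close> may depend on the last grid value and on the terminal value \<open>y\<close>; this generality
  is what the induction needs, since integrating out the last grid point turns \<open>\<phi>\<close> into another
  such function. The last grid point is integrated out on both sides by the Markov property, and
  the two results agree by \<open>bridge_step\<close>. The process with drift \<open>y / T\<close> is realised as
  \<open>X u + u (y / T - c)\<close>, so that a single space \<open>N\<close> carries all drifts.\<close>

lemma bridge_grid:
  fixes W :: "real \<Rightarrow> 'w \<Rightarrow> real ^ 'n" and X :: "real \<Rightarrow> 'v \<Rightarrow> real ^ 'n"
    and \<phi> :: "(real ^ 'n) \<times> (real ^ 'n) \<Rightarrow> ennreal" and u :: "nat \<Rightarrow> real"
  assumes W: "brownian_motion M W x b" and X: "brownian_motion N X x c" and T: "0 < T"
    and u: "u 0 = 0" "strict_mono u" and K: "\<And>i. K i \<in> sets borel"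
    and \<phi>: "\<phi> \<in> borel_measurable (borel \<Otimes>\<^sub>M borel)"
  defines "r \<equiv> \<lambda>i. (u i + T) / T" and "s \<equiv> \<lambda>i. u i * T / (u i + T)"
  shows "(\<integral>\<^sup>+\<omega>. (\<Prod>i\<le>k. indicator (K i) (r i *\<^sub>R W (s i) \<omega>)) *
        (\<integral>\<^sup>+y. ennreal (gauss_density ((T - s k) *\<^sub>R b) (T - s k) (y - W (s k) \<omega>)) *
           \<phi> (r k *\<^sub>R W (s k) \<omega>, y) \<partial>lborel) \<partial>M) =
    (\<integral>\<^sup>+y. ennreal (gauss_density (T *\<^sub>R b) T (y - x)) *
        (\<integral>\<^sup>+\<omega>. (\<Prod>i\<le>k. indicator (K i) (X (u i) \<omega> + u i *\<^sub>R (y /\<^sub>R T - c))) *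
           \<phi> (X (u k) \<omega> + u k *\<^sub>R (y /\<^sub>R T - c), y) \<partial>N) \<partial>lborel)"
  using \<phi>
proof (induction k arbitrary: \<phi>)
  case 0
  note [measurable] = 0
  interpret M: prob_space M by (rule brownian_motionD(1)[OF W])
  interpret N: prob_space N by (rule brownian_motionD(1)[OF X])
  have r0: "r 0 = 1" "s 0 = 0" using T u by (auto simp: r_def s_def)
  have "(\<integral>\<^sup>+\<omega>. indicator (K 0) (W 0 \<omega>) * (\<integral>\<^sup>+y. ennreal (gauss_density (T *\<^sub>R b) T (y - W 0 \<omega>)) *
           \<phi> (W 0 \<omega>, y) \<partial>lborel) \<partial>M) =
    (\<integral>\<^sup>+\<omega>. indicator (K 0) x * (\<integral>\<^sup>+y. ennreal (gauss_density (T *\<^sub>R b) T (y - x)) * \<phi> (x, y) \<partial>lborel) \<partial>M)"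
    using brownian_motionD(4)[OF W] by (intro nn_integral_cong_AE, eventually_elim) simp
  also have "\<dots> = indicator (K 0) x * (\<integral>\<^sup>+y. ennreal (gauss_density (T *\<^sub>R b) T (y - x)) * \<phi> (x, y) \<partial>lborel)"
    by (simp add: M.emeasure_space_1)
  also have "\<dots> = (\<integral>\<^sup>+y. indicator (K 0) x * (ennreal (gauss_density (T *\<^sub>R b) T (y - x)) * \<phi> (x, y)) \<partial>lborel)"
    by (rule nn_integral_cmult[symmetric]) simp
  also have "\<dots> = (\<integral>\<^sup>+y. ennreal (gauss_density (T *\<^sub>R b) T (y - x)) *
        (\<integral>\<^sup>+\<omega>. indicator (K 0) (X 0 \<omega>) * \<phi> (X 0 \<omega>, y) \<partial>N) \<partial>lborel)"
  proof (intro nn_integral_cong)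
    fix y
    have "(\<integral>\<^sup>+\<omega>. indicator (K 0) (X 0 \<omega>) * \<phi> (X 0 \<omega>, y) \<partial>N) = (\<integral>\<^sup>+\<omega>. indicator (K 0) x * \<phi> (x, y) \<partial>N)"
      using brownian_motionD(4)[OF X] by (intro nn_integral_cong_AE, eventually_elim) simp
    then show "indicator (K 0) x * (ennreal (gauss_density (T *\<^sub>R b) T (y - x)) * \<phi> (x, y)) =
      ennreal (gauss_density (T *\<^sub>R b) T (y - x)) * (\<integral>\<^sup>+\<omega>. indicator (K 0) (X 0 \<omega>) * \<phi> (X 0 \<omega>, y) \<partial>N)"
      by (simp add: N.emeasure_space_1 mult_ac)
  qed
  finally show ?case by (simp add: r0 u)
next
  case (Suc k)
  note [measurable] = \<open>\<phi> \<in> _\<close> K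
  have u0: "0 \<le> u i" for i using u strict_monoD[OF u(2), of 0 i] by (cases i) auto
  have s_mono: "strict_mono s"
    unfolding s_def by (rule strict_mono_bridge_time[OF u(2) u0 T])
  have s0: "s 0 = 0" using u by (simp add: s_def)
  define K' where "K' i = (\<lambda>w. r i *\<^sub>R w) -` K i" for i
  have [measurable]: "K' i \<in> sets borel" for i
    using measurable_sets_borel[of "\<lambda>w. r i *\<^sub>R w" borel "K i"] by (simp add: K'_def)
  have K': "indicator (K i) (r i *\<^sub>R w) = (indicator (K' i) w :: ennreal)" for i w
    by (simp add: K'_def indicator_vimage)
  let ?q = "\<lambda>y z. ennreal (gauss_density ((u (Suc k) - u k) *\<^sub>R (y /\<^sub>R T)) (u (Suc k) - u k) z)"
  \<comment> \<open>The constraint at the last grid point is absorbed into the observable before that point is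
    integrated out.\<close>
  define \<psi> where "\<psi> = (\<lambda>(z, y). indicator (K (Suc k)) z * \<phi> (z, y))"
  have [measurable]: "\<psi> \<in> borel_measurable (borel \<Otimes>\<^sub>M borel)"
    unfolding \<psi>_def by measurable
  define \<phi>' where "\<phi>' = (\<lambda>(z, y). \<integral>\<^sup>+\<zeta>. ?q y \<zeta> * \<psi> (z + \<zeta>, y) \<partial>lborel)"
  have \<phi>' [measurable]: "\<phi>' \<in> borel_measurable (borel \<Otimes>\<^sub>M borel)"
    unfolding \<phi>'_def by measurable
  define f where "f w = (\<integral>\<^sup>+y. ennreal (gauss_density ((T - s (Suc k)) *\<^sub>R b) (T - s (Suc k)) (y - w)) *
      \<psi> (r (Suc k) *\<^sub>R w, y) \<partial>lborel)" for w
  have [measurable]: "f \<in> borel_measurable borel"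
    unfolding f_def by measurable
  have step_W: "(\<integral>\<^sup>+z. ennreal (gauss_density ((s (Suc k) - s k) *\<^sub>R b) (s (Suc k) - s k) z) * f (w + z) \<partial>lborel) =
      (\<integral>\<^sup>+y. ennreal (gauss_density ((T - s k) *\<^sub>R b) (T - s k) (y - w)) * \<phi>' (r k *\<^sub>R w, y) \<partial>lborel)" for w
    unfolding f_def \<phi>'_def s_def r_def prod.case
    using u0[of k] u(2) T by (intro bridge_step) (auto simp: strict_mono_Suc_iff)
  have step_X: "(\<integral>\<^sup>+\<omega>. (\<Prod>i\<le>Suc k. indicator (K i) (X (u i) \<omega> + u i *\<^sub>R (y /\<^sub>R T - c))) *
           \<phi> (X (u (Suc k)) \<omega> + u (Suc k) *\<^sub>R (y /\<^sub>R T - c), y) \<partial>N) =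
      (\<integral>\<^sup>+\<omega>. (\<Prod>i\<le>k. indicator (K i) (X (u i) \<omega> + u i *\<^sub>R (y /\<^sub>R T - c))) *
           \<phi>' (X (u k) \<omega> + u k *\<^sub>R (y /\<^sub>R T - c), y) \<partial>N)" for y
  proof -
    have "brownian_motion N (\<lambda>t \<omega>. X t \<omega> + t *\<^sub>R (y /\<^sub>R T - c)) x (c + (y /\<^sub>R T - c))"
      by (rule brownian_motion_add_drift[OF X])
    then have "brownian_motion N (\<lambda>t \<omega>. X t \<omega> + t *\<^sub>R (y /\<^sub>R T - c)) x (y /\<^sub>R T)" by simp
    from brownian_motion_markov_step[OF this u K, where f="\<lambda>z. \<psi> (z, y)" and k=k]
    show ?thesis by (simp add: \<phi>'_def \<psi>_def mult.assoc add.assoc)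
  qed
  have "(\<integral>\<^sup>+\<omega>. (\<Prod>i\<le>Suc k. indicator (K i) (r i *\<^sub>R W (s i) \<omega>)) *
        (\<integral>\<^sup>+y. ennreal (gauss_density ((T - s (Suc k)) *\<^sub>R b) (T - s (Suc k)) (y - W (s (Suc k)) \<omega>)) *
           \<phi> (r (Suc k) *\<^sub>R W (s (Suc k)) \<omega>, y) \<partial>lborel) \<partial>M) =
      (\<integral>\<^sup>+\<omega>. (\<Prod>i\<le>k. indicator (K' i) (W (s i) \<omega>)) * f (W (s (Suc k)) \<omega>) \<partial>M)"
  proof (intro nn_integral_cong)
    fix \<omega>
    have "f w = indicator (K' (Suc k)) w * (\<integral>\<^sup>+y. ennreal (gauss_density ((T - s (Suc k)) *\<^sub>R b) (T - s (Suc k)) (y - w)) *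
           \<phi> (r (Suc k) *\<^sub>R w, y) \<partial>lborel)" for w
      unfolding f_def \<psi>_def prod.case K'[symmetric]
      by (subst nn_integral_cmult[symmetric]) (auto intro!: nn_integral_cong simp: mult_ac)
    then show "(\<Prod>i\<le>Suc k. indicator (K i) (r i *\<^sub>R W (s i) \<omega>)) *
        (\<integral>\<^sup>+y. ennreal (gauss_density ((T - s (Suc k)) *\<^sub>R b) (T - s (Suc k)) (y - W (s (Suc k)) \<omega>)) *
           \<phi> (r (Suc k) *\<^sub>R W (s (Suc k)) \<omega>, y) \<partial>lborel) =
      (\<Prod>i\<le>k. indicator (K' i) (W (s i) \<omega>)) * f (W (s (Suc k)) \<omega>)"
      by (simp add: K' mult.assoc)
  qed
  also have "\<dots> = (\<integral>\<^sup>+\<omega>. (\<Prod>i\<le>k. indicator (K' i) (W (s i) \<omega>)) *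
      (\<integral>\<^sup>+z. ennreal (gauss_density ((s (Suc k) - s k) *\<^sub>R b) (s (Suc k) - s k) z) *
         f (W (s k) \<omega> + z) \<partial>lborel) \<partial>M)"
    by (rule brownian_motion_markov_step[OF W s0 s_mono]) auto
  also have "\<dots> = (\<integral>\<^sup>+\<omega>. (\<Prod>i\<le>k. indicator (K i) (r i *\<^sub>R W (s i) \<omega>)) *
        (\<integral>\<^sup>+y. ennreal (gauss_density ((T - s k) *\<^sub>R b) (T - s k) (y - W (s k) \<omega>)) *
           \<phi>' (r k *\<^sub>R W (s k) \<omega>, y) \<partial>lborel) \<partial>M)"
    by (simp only: step_W K')
  also have "\<dots> = (\<integral>\<^sup>+y. ennreal (gauss_density (T *\<^sub>R b) T (y - x)) *
        (\<integral>\<^sup>+\<omega>. (\<Prod>i\<le>k. indicator (K i) (X (u i) \<omega> + u i *\<^sub>R (y /\<^sub>R T - c))) *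
           \<phi>' (X (u k) \<omega> + u k *\<^sub>R (y /\<^sub>R T - c), y) \<partial>N) \<partial>lborel)"
    by (rule Suc.IH[OF \<phi>'])
  finally show ?case by (simp only: step_X)
qed

section \<open>Time inversion on path space\<close>

lemma strict_mono_extend:
  fixes u :: "nat \<Rightarrow> real"
  assumes "strict_mono u" "u k < b"
  shows "strict_mono (\<lambda>i. if i \<le> k then u i else b + real (i - Suc k))"
proof -
  let ?v = "\<lambda>i. if i \<le> k then u i else b + real (i - Suc k)"
  have "?v i < ?v (Suc i)" for i
    using assms by (cases i k rule: linorder_cases) (auto simp: strict_mono_Suc_iff)
  then show ?thesis
    unfolding strict_mono_Suc_iff by blast
qed

lemma emeasure_distr_density:
  assumes [measurable]: "g \<in> borel_measurable M" "f \<in> measurable M N" "F \<in> sets N"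
  shows "emeasure (distr (density M g) N f) F = (\<integral>\<^sup>+x. g x * indicator F (f x) \<partial>M)"
proof -
  have "emeasure (distr (density M g) N f) F = (\<integral>\<^sup>+y. indicator F y \<partial>distr (density M g) N f)"
    by simp
  then show ?thesis
    by (simp add: nn_integral_distr nn_integral_density del: nn_integral_indicator)
qed

lemma finite_times_enumerate:
  fixes J :: "real set"
  assumes "finite J" "J \<subseteq> {0..}"
  obtains u :: "nat \<Rightarrow> real" and k where "strict_mono u" "u 0 = 0" "insert 0 J = u ` {..k}"
proof -
  have "\<exists>(u :: nat \<Rightarrow> real) k. strict_mono u \<and> u 0 = 0 \<and> insert 0 J = u ` {..k}"
    using assms
  proof (induction J rule: finite_linorder_max_induct)
    case empty
    show ?case by (intro exI[of _ real] exI[of _ 0]) (auto simp: strict_mono_def)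
  next
    case (insert b A)
    then obtain u :: "nat \<Rightarrow> real" and k where u: "strict_mono u" "u 0 = 0" "insert 0 A = u ` {..k}"
      by auto
    show ?case
    proof (cases "b = 0")
      case True
      then show ?thesis using u by auto
    next
      case False
      then have "u k < b" using insert u(3) by (metis atLeast_iff atMost_iff image_eqI insertE insertI1
          insert_subset less_eq_real_def order.refl)
      note mono = strict_mono_extend[OF u(1) this]
      let ?u = "\<lambda>i. if i \<le> k then u i else b + real (i - Suc k)"
      have "?u ` {..Suc k} = insert b (u ` {..k})"
        by (auto simp: atMost_Suc image_iff)
      then have "insert 0 (insert b A) = ?u ` {..Suc k}" using u(3) by auto
      then show ?thesis using mono u(2) by (intro exI[of _ ?u] exI[of _ "Suc k"]) auto
    qed
  qed
  then show ?thesis using that by blast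
qed

text \<open>Time inversion that sends the time interval \<open>[0, T)\<close> to \<open>[0, \<infinity>)\<close>. For large \<open>u\<close> the value divided by
  \<open>u\<close> approaches \<open>v T / T\<close>, which is why the terminal value becomes a drift. Since points are only
  multiplied by positive numbers, the inverted path lies in a cone exactly when the original one
  does.\<close>

definition bridge_path :: "real \<Rightarrow> (real \<Rightarrow> 'a :: real_vector) \<Rightarrow> real \<Rightarrow> 'a" where
  "bridge_path T v u = ((u + T) / T) *\<^sub>R v (u * T / (u + T))"

text \<open>The key identity. Given that \<open>W T = y\<close>, the time-inverted path of \<open>W\<close> on \<open>[0, T)\<close> is Brownian motion
  with drift \<open>y / T\<close>, whatever the drift of \<open>W\<close> was. Both sides are finite measures in \<open>E\<close>, so it
  suffices to compare them on cylinder sets, which is the finite-dimensional statement above.\<close>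

lemma bridge_law:
  fixes W :: "real \<Rightarrow> 'w \<Rightarrow> real ^ 'n" and X :: "real \<Rightarrow> 'v \<Rightarrow> real ^ 'n"
  assumes W: "brownian_motion M W x b" and X: "brownian_motion N X x c" and T: "0 < T"
    and A [measurable]: "A \<in> sets borel" and E: "E \<in> sets (PiM {0..} (\<lambda>_. borel))"
  shows "emeasure M {\<omega> \<in> space M. restrict (bridge_path T (\<lambda>t. W t \<omega>)) {0..} \<in> E \<and> W T \<omega> \<in> A} =
    (\<integral>\<^sup>+y\<in>A. ennreal (gauss_density (T *\<^sub>R b) T (y - x)) *
        emeasure N {\<omega> \<in> space N. (\<lambda>u\<in>{0..}. X u \<omega> + u *\<^sub>R (y /\<^sub>R T - c)) \<in> E} \<partial>lborel)"
proof -
  interpret M: prob_space M by (rule brownian_motionD(1)[OF W])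
  interpret N: prob_space N by (rule brownian_motionD(1)[OF X])
  note meas = brownian_motionD(2)[OF W] brownian_motionD(2)[OF X]
  let ?P = "PiM {0..} (\<lambda>_ :: real. borel :: (real ^ 'n) measure)"
  let ?w = "\<lambda>\<omega>. restrict (bridge_path T (\<lambda>t. W t \<omega>)) {0..}"
  let ?x = "\<lambda>(y, \<omega>). \<lambda>u\<in>{0..}. X u \<omega> + u *\<^sub>R (y /\<^sub>R T - c)"
  let ?g = "\<lambda>(y, \<omega>). ennreal (gauss_density (T *\<^sub>R b) T (y - x)) * indicator A y"
  have [measurable]: "W T \<in> borel_measurable M" using T by (intro meas) simp
  have w [measurable]: "?w \<in> measurable M ?P"
    unfolding bridge_path_def using T
    by (intro measurable_restrict borel_measurable_scaleR meas borel_measurable_const) auto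
  have x [measurable]: "?x \<in> measurable (lborel \<Otimes>\<^sub>M N) ?P"
    unfolding split_beta
    by (intro measurable_restrict) (use meas(2) in measurable)
  have [measurable]: "?g \<in> borel_measurable (lborel \<Otimes>\<^sub>M N)" by measurable
  define L where "L = distr (density M (\<lambda>\<omega>. indicator A (W T \<omega>))) ?P ?w"
  define R where "R = distr (density (lborel \<Otimes>\<^sub>M N) ?g) ?P ?x"
  have L: "emeasure L F = (\<integral>\<^sup>+\<omega>. indicator A (W T \<omega>) * indicator F (?w \<omega>) \<partial>M)"
    if [measurable]: "F \<in> sets ?P" for F
    unfolding L_def by (rule emeasure_distr_density) measurable
  have R: "emeasure R F = (\<integral>\<^sup>+y. ennreal (gauss_density (T *\<^sub>R b) T (y - x)) * indicator A y *
      (\<integral>\<^sup>+\<omega>. indicator F (?x (y, \<omega>)) \<partial>N) \<partial>lborel)" if [measurable]: "F \<in> sets ?P" for F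
  proof -
    have "emeasure R F = (\<integral>\<^sup>+p. ?g p * indicator F (?x p) \<partial>(lborel \<Otimes>\<^sub>M N))"
      unfolding R_def by (rule emeasure_distr_density) measurable
    also have "\<dots> = (\<integral>\<^sup>+y. \<integral>\<^sup>+\<omega>. ?g (y, \<omega>) * indicator F (?x (y, \<omega>)) \<partial>N \<partial>lborel)"
      by (rule N.nn_integral_fst[symmetric]) measurable
    also have "\<dots> = (\<integral>\<^sup>+y. ennreal (gauss_density (T *\<^sub>R b) T (y - x)) * indicator A y *
      (\<integral>\<^sup>+\<omega>. indicator F (?x (y, \<omega>)) \<partial>N) \<partial>lborel)"
      unfolding prod.case
      by (intro nn_integral_cong nn_integral_cmult) (use x in measurable)
    finally show ?thesis .
  qed
  have "L = R"
  proof (rule measure_eqI_PiM_infinite)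
    show "finite_measure L"
    proof
      have "space L = space ?P" by (simp add: L_def)
      then have "emeasure L (space L) = (\<integral>\<^sup>+\<omega>. indicator A (W T \<omega>) * indicator (space ?P) (?w \<omega>) \<partial>M)"
        using L[OF sets.top] by simp
      also have "\<dots> \<le> (\<integral>\<^sup>+\<omega>. 1 \<partial>M)"
        by (intro nn_integral_mono) (simp split: split_indicator)
      finally have "emeasure L (space L) \<le> 1" by (simp add: M.emeasure_space_1)
      then show "emeasure L (space L) \<noteq> \<infinity>"
        by (auto simp: top_unique)
    qed
    fix D :: "real \<Rightarrow> (real ^ 'n) set" and J :: "real set"
    assume J: "finite J" "J \<subseteq> {0..}" and D: "\<And>j. j \<in> J \<Longrightarrow> D j \<in> sets borel"
    let ?F = "prod_emb {0..} (\<lambda>_. borel) J (Pi\<^sub>E J D)"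
    obtain u :: "nat \<Rightarrow> real" and k where u: "strict_mono u" "u 0 = 0" "insert 0 J = u ` {..k}"
      using finite_times_enumerate[OF J] by metis
    define K where "K i = (if u i \<in> J then D (u i) else UNIV)" for i
    have K [measurable]: "K i \<in> sets borel" for i using D by (auto simp: K_def)
    have u0: "0 \<le> u i" for i using u(1,2) strict_monoD[OF u(1), of 0 i] by (cases i) auto
    have F [measurable]: "?F \<in> sets ?P" by (rule sets_PiM_I) (use J D in auto)
    have cyl: "(indicator ?F (restrict v {0..}) :: ennreal) = (\<Prod>i\<le>k. indicator (K i) (v (u i)))" for v
    proof -
      have "restrict v {0..} \<in> ?F \<longleftrightarrow> (\<forall>j\<in>J. v j \<in> D j)"
        using J by (auto simp: prod_emb_def PiE_iff)
      also have "\<dots> \<longleftrightarrow> (\<forall>i\<le>k. v (u i) \<in> K i)"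
        using u(3) unfolding K_def by (auto simp: set_eq_iff image_iff) (metis atMost_iff)
      finally show ?thesis
        by (auto simp: indicator_def prod_zero_iff intro!: prod.neutral[symmetric])
    qed
    define s where "s i = u i * T / (u i + T)" for i
    define r where "r i = (u i + T) / T" for i
    have sT: "s i < T" for i using u0[of i] T by (simp add: s_def divide_simps)
    have s_mono: "strict_mono s"
      unfolding s_def[abs_def] by (rule strict_mono_bridge_time[OF u(1) u0 T])
    \<comment> \<open>The inverted grid, followed by the terminal time at index \<open>Suc k\<close>, continued to a
      strictly increasing sequence.\<close>
    define t where "t i = (if i \<le> k then s i else T + real (i - Suc k))" for i
    have t: "strict_mono t" "t 0 = 0"
      using strict_mono_extend[OF s_mono sT] u(2) by (auto simp: t_def[abs_def] s_def)
    define K' where "K' i = (\<lambda>w. r i *\<^sub>R w) -` K i" for i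
    have [measurable]: "K' i \<in> sets borel" for i
      using measurable_sets_borel[of "\<lambda>w. r i *\<^sub>R w" borel "K i"] by (simp add: K'_def)
    have K': "indicator (K i) (r i *\<^sub>R w) = (indicator (K' i) w :: ennreal)" for i w
      by (simp add: K'_def indicator_vimage)
    have "emeasure L ?F = (\<integral>\<^sup>+\<omega>. (\<Prod>i\<le>k. indicator (K' i) (W (t i) \<omega>)) * indicator A (W (t (Suc k)) \<omega>) \<partial>M)"
      unfolding L[OF F] cyl bridge_path_def r_def[symmetric] s_def[symmetric] K'
      by (simp add: t_def mult.commute)
    also have "\<dots> = (\<integral>\<^sup>+\<omega>. (\<Prod>i\<le>k. indicator (K' i) (W (t i) \<omega>)) *
      (\<integral>\<^sup>+z. ennreal (gauss_density ((t (Suc k) - t k) *\<^sub>R b) (t (Suc k) - t k) z) *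
         indicator A (W (t k) \<omega> + z) \<partial>lborel) \<partial>M)"
      by (rule brownian_motion_markov_step[OF W t(2,1)]) auto
    also have "\<dots> = (\<integral>\<^sup>+\<omega>. (\<Prod>i\<le>k. indicator (K i) (r i *\<^sub>R W (s i) \<omega>)) *
        (\<integral>\<^sup>+y. ennreal (gauss_density ((T - s k) *\<^sub>R b) (T - s k) (y - W (s k) \<omega>)) * indicator A y \<partial>lborel) \<partial>M)"
    proof (intro nn_integral_cong)
      fix \<omega>
      have "(\<integral>\<^sup>+z. ennreal (gauss_density ((T - s k) *\<^sub>R b) (T - s k) z) * indicator A (W (s k) \<omega> + z) \<partial>lborel) =
          (\<integral>\<^sup>+z. ennreal (gauss_density ((T - s k) *\<^sub>R b) (T - s k) (W (s k) \<omega> + z - W (s k) \<omega>)) *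
            indicator A (W (s k) \<omega> + z) \<partial>lborel)"
        by simp
      also have "\<dots> = (\<integral>\<^sup>+y. ennreal (gauss_density ((T - s k) *\<^sub>R b) (T - s k) (y - W (s k) \<omega>)) * indicator A y \<partial>lborel)"
        by (rule nn_integral_lborel_translate) simp
      finally show "(\<Prod>i\<le>k. indicator (K' i) (W (t i) \<omega>)) *
          (\<integral>\<^sup>+z. ennreal (gauss_density ((t (Suc k) - t k) *\<^sub>R b) (t (Suc k) - t k) z) *
             indicator A (W (t k) \<omega> + z) \<partial>lborel) =
        (\<Prod>i\<le>k. indicator (K i) (r i *\<^sub>R W (s i) \<omega>)) *
          (\<integral>\<^sup>+y. ennreal (gauss_density ((T - s k) *\<^sub>R b) (T - s k) (y - W (s k) \<omega>)) * indicator A y \<partial>lborel)"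
        by (simp add: t_def K')
    qed
    also have "\<dots> = (\<integral>\<^sup>+y. ennreal (gauss_density (T *\<^sub>R b) T (y - x)) *
        (\<integral>\<^sup>+\<omega>. (\<Prod>i\<le>k. indicator (K i) (X (u i) \<omega> + u i *\<^sub>R (y /\<^sub>R T - c))) * indicator A y \<partial>N) \<partial>lborel)"
      using bridge_grid[OF W X T u(2,1) K, where \<phi>="\<lambda>(z, y). indicator A y" and k=k]
      unfolding s_def r_def by simp
    also have "\<dots> = emeasure R ?F"
      unfolding R[OF F] prod.case cyl
    proof (intro nn_integral_cong)
      fix y
      have [measurable]: "X (u i) \<in> borel_measurable N" for i using u0 by (rule meas)
      have "(\<integral>\<^sup>+\<omega>. (\<Prod>i\<le>k. indicator (K i) (X (u i) \<omega> + u i *\<^sub>R (y /\<^sub>R T - c))) * indicator A y \<partial>N) =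
          (\<integral>\<^sup>+\<omega>. (\<Prod>i\<le>k. indicator (K i) (X (u i) \<omega> + u i *\<^sub>R (y /\<^sub>R T - c))) \<partial>N) * indicator A y"
        by (rule nn_integral_multc) measurable
      then show "ennreal (gauss_density (T *\<^sub>R b) T (y - x)) *
          (\<integral>\<^sup>+\<omega>. (\<Prod>i\<le>k. indicator (K i) (X (u i) \<omega> + u i *\<^sub>R (y /\<^sub>R T - c))) * indicator A y \<partial>N) =
        ennreal (gauss_density (T *\<^sub>R b) T (y - x)) * indicator A y *
          (\<integral>\<^sup>+\<omega>. (\<Prod>i\<le>k. indicator (K i) (X (u i) \<omega> + u i *\<^sub>R (y /\<^sub>R T - c))) \<partial>N)"
        by (simp add: mult_ac)
    qed
    finally show "emeasure L ?F = emeasure R ?F" .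
  qed (simp_all add: L_def R_def)
  note [measurable] = E
  have "emeasure M {\<omega> \<in> space M. ?w \<omega> \<in> E \<and> W T \<omega> \<in> A} =
      (\<integral>\<^sup>+\<omega>. indicator {\<omega> \<in> space M. ?w \<omega> \<in> E \<and> W T \<omega> \<in> A} \<omega> \<partial>M)"
    by (rule nn_integral_indicator[symmetric]) measurable
  also have "\<dots> = emeasure L E"
    unfolding L[OF E] by (intro nn_integral_cong) (simp split: split_indicator)
  also have "\<dots> = emeasure R E" using \<open>L = R\<close> by simp
  also have "\<dots> = (\<integral>\<^sup>+y\<in>A. ennreal (gauss_density (T *\<^sub>R b) T (y - x)) *
        emeasure N {\<omega> \<in> space N. (\<lambda>u\<in>{0..}. X u \<omega> + u *\<^sub>R (y /\<^sub>R T - c)) \<in> E} \<partial>lborel)"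
    unfolding R[OF E] prod.case
  proof (intro nn_integral_cong)
    fix y
    have [measurable]: "(\<lambda>\<omega>. \<lambda>u\<in>{0..}. X u \<omega> + u *\<^sub>R (y /\<^sub>R T - c)) \<in> measurable N ?P"
      by (intro measurable_restrict) (use meas(2) in measurable)
    have "(\<integral>\<^sup>+\<omega>. indicator E (\<lambda>u\<in>{0..}. X u \<omega> + u *\<^sub>R (y /\<^sub>R T - c)) \<partial>N) =
        (\<integral>\<^sup>+\<omega>. indicator {\<omega> \<in> space N. (\<lambda>u\<in>{0..}. X u \<omega> + u *\<^sub>R (y /\<^sub>R T - c)) \<in> E} \<omega> \<partial>N)"
      by (intro nn_integral_cong) (simp split: split_indicator)
    also have "\<dots> = emeasure N {\<omega> \<in> space N. (\<lambda>u\<in>{0..}. X u \<omega> + u *\<^sub>R (y /\<^sub>R T - c)) \<in> E}"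
      by (rule nn_integral_indicator) measurable
    finally show "ennreal (gauss_density (T *\<^sub>R b) T (y - x)) * indicator A y *
        (\<integral>\<^sup>+\<omega>. indicator E (\<lambda>u\<in>{0..}. X u \<omega> + u *\<^sub>R (y /\<^sub>R T - c)) \<partial>N) =
      ennreal (gauss_density (T *\<^sub>R b) T (y - x)) *
        emeasure N {\<omega> \<in> space N. (\<lambda>u\<in>{0..}. X u \<omega> + u *\<^sub>R (y /\<^sub>R T - c)) \<in> E} * indicator A y"
      by (simp add: mult_ac)
  qed
  finally show ?thesis .
qed

section \<open>Cones, exit times and confined paths\<close>

lemma normal_cone_open:
  assumes "normal_cone C"
  shows "open C"
proof -
  obtain \<Theta> where \<Theta>: "\<Theta> \<subset> sphere 0 1" "openin (top_of_set (sphere 0 1)) \<Theta>"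
    and C: "C = {r *\<^sub>R \<theta> | r \<theta>. 0 < r \<and> \<theta> \<in> \<Theta>}"
    using assms unfolding normal_cone_def by blast
  obtain U where U: "open U" "\<Theta> = sphere 0 1 \<inter> U"
    using \<Theta>(2) by (auto simp: openin_open)
  have "C = - {0} \<inter> sgn -` U"
  proof (rule set_eqI)
    fix z
    show "z \<in> C \<longleftrightarrow> z \<in> - {0} \<inter> sgn -` U"
    proof
      assume "z \<in> C"
      then obtain r \<theta> where z: "z = r *\<^sub>R \<theta>" "0 < r" "\<theta> \<in> \<Theta>" using C by blast
      then have "norm \<theta> = 1" using \<Theta>(1) by auto
      then have "sgn z = \<theta>" "z \<noteq> 0" using z by (auto simp: sgn_scaleR sgn_div_norm)
      then show "z \<in> - {0} \<inter> sgn -` U" using z U by simp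
    next
      assume z: "z \<in> - {0} \<inter> sgn -` U"
      then have "sgn z \<in> \<Theta>" "z = norm z *\<^sub>R sgn z" using U by (auto simp: norm_sgn sgn_div_norm)
      then show "z \<in> C" using z C by (auto intro!: exI[of _ "norm z"] exI[of _ "sgn z"])
    qed
  qed
  moreover have "open (- {0} \<inter> sgn -` U)"
    by (rule continuous_open_preimage) (auto intro!: continuous_intros U)
  ultimately show ?thesis by simp
qed

lemma normal_cone_scaleR:
  assumes "normal_cone C" "0 < r"
  shows "r *\<^sub>R z \<in> C \<longleftrightarrow> z \<in> C"
proof -
  have *: "r *\<^sub>R z \<in> C" if "z \<in> C" "0 < r" for r z
  proof -
    obtain \<Theta> where C: "C = {r *\<^sub>R \<theta> | r \<theta>. 0 < r \<and> \<theta> \<in> \<Theta>}"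
      using assms(1) unfolding normal_cone_def by blast
    with that obtain q \<theta> where "z = q *\<^sub>R \<theta>" "0 < q" "\<theta> \<in> \<Theta>" by blast
    then show ?thesis using C that(2) by (auto intro!: exI[of _ "r * q"])
  qed
  from *[of z r] *[of "r *\<^sub>R z" "inverse r"] assms(2) show ?thesis by auto
qed

lemma zero_notin_normal_cone: "normal_cone C \<Longrightarrow> 0 \<notin> C"
  unfolding normal_cone_def by fastforce

lemma exit_time_eq_infinity_iff: "exit_time C v = \<infinity> \<longleftrightarrow> (\<forall>u>0. v u \<in> C)"
proof -
  have "exit_time C v = \<infinity> \<longleftrightarrow> (\<forall>z \<in> ereal ` {t. 0 < t \<and> v t \<notin> C}. z = top)"
    unfolding exit_time_def by (simp add: top_ereal_def[symmetric] Inf_top_conv)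
  also have "\<dots> \<longleftrightarrow> (\<forall>u>0. v u \<in> C)" by (auto simp: top_ereal_def)
  finally show ?thesis .
qed

text \<open>The closed interval is correct although the exit time is an infimum: at time \<open>t\<close> the path is in the
  open set \<open>C\<close> and therefore stays there a little longer.\<close>

lemma less_exit_time_iff:
  assumes C: "open C" and v: "continuous_on {0..} v" and t: "0 < t"
  shows "ereal t < exit_time C v \<longleftrightarrow> (\<forall>s\<in>{0<..t}. v s \<in> C)"
proof
  assume less: "ereal t < exit_time C v"
  show "\<forall>s\<in>{0<..t}. v s \<in> C"
  proof (rule ballI, rule ccontr)
    fix s assume s: "s \<in> {0<..t}" "v s \<notin> C"
    then have "exit_time C v \<le> ereal s" unfolding exit_time_def by (intro Inf_lower) auto
    also have "ereal s \<le> ereal t" using s by simp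
    finally show False using less by simp
  qed
next
  assume stay: "\<forall>s\<in>{0<..t}. v s \<in> C"
  have "open ({0<..} \<inter> v -` C)"
    by (rule continuous_open_preimage) (auto intro: C continuous_on_subset[OF v])
  moreover have "t \<in> {0<..} \<inter> v -` C" using stay t by simp
  ultimately obtain e where e: "0 < e" "ball t e \<subseteq> {0<..} \<inter> v -` C"
    by (meson open_contains_ball)
  have "ereal (t + e) \<le> ereal s" if "0 < s" "v s \<notin> C" for s
  proof (rule ccontr)
    assume "\<not> ereal (t + e) \<le> ereal s"
    then have "s < t + e" by simp
    moreover have "t < s" using stay that by (meson greaterThanAtMost_iff not_le_imp_less)
    ultimately have "s \<in> ball t e" by (simp add: dist_real_def)
    then show False using e that by auto
  qed
  then have "ereal (t + e) \<le> exit_time C v"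
    unfolding exit_time_def by (intro Inf_greatest) auto
  moreover have "ereal t < ereal (t + e)" using e by simp
  ultimately show "ereal t < exit_time C v" by (rule less_le_trans[rotated])
qed

lemma in_closure_rationals:
  fixes u :: real
  assumes "a < b" "u \<in> {a..b}"
  shows "u \<in> closure (\<rat> \<inter> {a..b})"
  unfolding closure_approachable
proof (intro allI impI)
  fix e :: real assume e: "0 < e"
  have "\<exists>q\<in>\<rat>. max a (u - e) < q \<and> q < min b (u + e)"
    using assms e by (intro Rats_dense_in_real) auto
  then obtain q where "q \<in> \<rat>" "max a (u - e) < q" "q < min b (u + e)" by blast
  then show "\<exists>q\<in>\<rat> \<inter> {a..b}. dist q u < e"
    by (intro bexI[of _ q]) (auto simp: dist_real_def)
qed

lemma continuous_ge_if_rationals_ge: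
  fixes f :: "real \<Rightarrow> real"
  assumes "continuous_on {a..b} f" "a < b" "u \<in> {a..b}"
    and "\<And>q. q \<in> \<rat> \<Longrightarrow> q \<in> {a..b} \<Longrightarrow> m \<le> f q"
  shows "m \<le> f u"
proof (rule continuous_ge_on_closure[of "\<rat> \<inter> {a..b}" f])
  show "continuous_on (closure (\<rat> \<inter> {a..b})) f"
    by (rule continuous_on_subset[OF assms(1)]) (intro closure_minimal, auto)
qed (use assms in_closure_rationals in auto)

text \<open>Staying in an open set at all positive times, expressed through countably many coordinates so that
  it is an event of the product space: on each compact time interval the path keeps a positive
  distance from the complement, and for continuous paths it is enough to test rational times. The
  intervals stay away from \<open>0\<close> because the starting point is not constrained.\<close>

definition confined_paths :: "'a :: euclidean_space set \<Rightarrow> (real \<Rightarrow> 'a) set" where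
  "confined_paths C = {v \<in> space (PiM {0..} (\<lambda>_. borel)). \<forall>k::nat. \<exists>m::nat.
     \<forall>q\<in>\<rat> \<inter> {1 / (real k + 2)..real k + 2}. 1 / (real m + 1) \<le> infdist (v q) (- C)}"

lemma confined_paths_measurable [measurable]: "confined_paths C \<in> sets (PiM {0..} (\<lambda>_. borel))"
  unfolding confined_paths_def
proof (intro sets.sets_Collect_countable_All sets.sets_Collect_countable_Ex sets.sets_Collect_countable_All')
  fix k m :: nat and q :: real
  assume "q \<in> \<rat> \<inter> {1 / (real k + 2)..real k + 2}"
  then have "q \<in> {0..}"
    by (auto intro: order_trans[rotated])
  then have [measurable]: "(\<lambda>v. v q) \<in> measurable (PiM {0..} (\<lambda>_. borel)) borel"
    by (rule measurable_component_singleton)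
  show "{v \<in> space (PiM {0..} (\<lambda>_. borel)). 1 / (real m + 1) \<le> infdist (v q) (- C)} \<in> sets (PiM {0..} (\<lambda>_. borel))"
  proof -
    have [measurable]: "(\<lambda>z. infdist z (- C)) \<in> borel_measurable borel"
      by (intro borel_measurable_continuous_onI continuous_intros)
    show ?thesis by measurable
  qed
qed (auto intro: countable_subset[OF _ countable_rat])

lemma confined_paths_iff:
  assumes C: "open C" "C \<noteq> UNIV" and v: "continuous_on {0..} v"
  shows "restrict v {0..} \<in> confined_paths C \<longleftrightarrow> (\<forall>u>0. v u \<in> C)"
proof -
  have cont: "continuous_on {1 / (real k + 2)..real k + 2} (\<lambda>u. infdist (v u) (- C))" for k :: nat
    by (intro continuous_on_infdist continuous_on_subset[OF v]) (auto intro: order_trans[rotated])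
  have lt: "1 / (real k + 2) < real k + 2" for k :: nat
    by (simp add: divide_simps algebra_simps add_pos_nonneg)
  have pos: "0 < q" if "q \<in> {1 / (real k + 2)..real k + 2}" for q and k :: nat
    using that by (auto intro: less_le_trans[rotated])
  have infdist_pos: "z \<in> C \<longleftrightarrow> 0 < infdist z (- C)" for z
  proof -
    have "closed (- C)" "- C \<noteq> {}" using C by auto
    from in_closed_iff_infdist_zero[OF this, of z] show ?thesis
      using infdist_nonneg[of z "- C"] by auto
  qed
  have "restrict v {0..} \<in> confined_paths C \<longleftrightarrow> (\<forall>k::nat. \<exists>m::nat.
     \<forall>q\<in>\<rat> \<inter> {1 / (real k + 2)..real k + 2}. 1 / (real m + 1) \<le> infdist (v q) (- C))"
  proof -
    have "(\<forall>q\<in>\<rat> \<inter> {1 / (real k + 2)..real k + 2}. l \<le> infdist (restrict v {0..} q) (- C)) \<longleftrightarrow>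
        (\<forall>q\<in>\<rat> \<inter> {1 / (real k + 2)..real k + 2}. l \<le> infdist (v q) (- C))" for k :: nat and l
    proof (rule ball_cong)
      fix q assume "q \<in> \<rat> \<inter> {1 / (real k + 2)..real k + 2}"
      then have "0 < q" using pos by blast
      then show "l \<le> infdist (restrict v {0..} q) (- C) \<longleftrightarrow> l \<le> infdist (v q) (- C)" by simp
    qed simp
    moreover have "restrict v {0..} \<in> space (PiM {0..} (\<lambda>_. borel))" by (simp add: space_PiM)
    ultimately show ?thesis unfolding confined_paths_def mem_Collect_eq by simp
  qed
  also have "\<dots> \<longleftrightarrow> (\<forall>u>0. v u \<in> C)"
  proof safe
    fix u :: real
    assume *: "\<forall>k::nat. \<exists>m::nat. \<forall>q\<in>\<rat> \<inter> {1 / (real k + 2)..real k + 2}.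
        1 / (real m + 1) \<le> infdist (v q) (- C)" and u: "0 < u"
    obtain k :: nat where k: "max u (1 / u) < real k" using reals_Archimedean2 by blast
    then have "1 / u \<le> real k + 2" by simp
    then have uk: "u \<in> {1 / (real k + 2)..real k + 2}"
      using k u by (auto simp: divide_simps mult.commute)
    obtain m :: nat where m: "\<And>q. q \<in> \<rat> \<inter> {1 / (real k + 2)..real k + 2} \<Longrightarrow> 1 / (real m + 1) \<le> infdist (v q) (- C)"
      using * by blast
    have "1 / (real m + 1) \<le> infdist (v u) (- C)"
      using m by (intro continuous_ge_if_rationals_ge[OF cont lt uk]) auto
    then have "0 < infdist (v u) (- C)" by (rule less_le_trans[rotated]) simp
    then show "v u \<in> C" using infdist_pos by simp
  next
    fix k :: nat
    assume stay: "\<forall>u>0. v u \<in> C"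
    obtain u where u: "u \<in> {1 / (real k + 2)..real k + 2}"
      "\<And>q. q \<in> {1 / (real k + 2)..real k + 2} \<Longrightarrow> infdist (v u) (- C) \<le> infdist (v q) (- C)"
      using continuous_attains_inf[OF compact_Icc _ cont[of k]] lt[of k] by fastforce
    have "0 < infdist (v u) (- C)" using stay pos[OF u(1)] infdist_pos by blast
    then obtain m :: nat where "inverse (real (Suc m)) < infdist (v u) (- C)"
      using reals_Archimedean by blast
    then show "\<exists>m::nat. \<forall>q\<in>\<rat> \<inter> {1 / (real k + 2)..real k + 2}. 1 / (real m + 1) \<le> infdist (v q) (- C)"
      using u(2) by (intro exI[of _ m]) (force simp: inverse_eq_divide add.commute)
  qed
  finally show ?thesis .
qed

section \<open>Confinement under time inversion\<close>

text \<open>Here \<open>X\<close> is meant to be a Brownian motion with drift \<open>c\<close>; adding \<open>u (y - c)\<close> changes its drift to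
  \<open>y\<close>. So this is the probability that Brownian motion with drift \<open>y\<close> never leaves \<open>C\<close>, with the
  same probability space for all \<open>y\<close>.\<close>

definition confinement :: "'v measure \<Rightarrow> (real \<Rightarrow> 'v \<Rightarrow> real ^ 'n) \<Rightarrow> real ^ 'n \<Rightarrow> (real ^ 'n) set \<Rightarrow> real ^ 'n \<Rightarrow> ennreal" where
  "confinement N X c C y = emeasure N {\<omega> \<in> space N. \<forall>u>0. X u \<omega> + u *\<^sub>R (y - c) \<in> C}"

lemma nn_integral_gauss_density:
  assumes "brownian_motion M W x b" "0 < T"
  shows "(\<integral>\<^sup>+y. ennreal (gauss_density (T *\<^sub>R b) T (y - x)) \<partial>lborel) = 1"
proof -
  interpret M: prob_space M by (rule brownian_motionD(1)[OF assms(1)])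
  let ?P = "PiM {0..} (\<lambda>_. borel)"
  have "{\<omega> \<in> space M. restrict v {0..} \<in> space ?P \<and> W T \<omega> \<in> UNIV} = space M" for v
    by (auto simp: space_PiM)
  moreover have "{\<omega> \<in> space M. (\<lambda>u\<in>{0..}. X u \<omega>) \<in> space ?P} = space M" for X
    by (auto simp: space_PiM)
  ultimately show ?thesis
    using bridge_law[OF assms(1,1,2) _ sets.top, of UNIV]
    by (simp add: M.emeasure_space_1 space_PiM)
qed

lemma continuous_on_bridge_path:
  fixes v :: "real \<Rightarrow> 'a :: real_normed_vector"
  assumes "continuous_on {0..} v" "0 < T"
  shows "continuous_on {0..} (bridge_path T v)"
  unfolding bridge_path_def using assms(2)
  by (intro continuous_intros continuous_on_compose2[OF assms(1)]) auto

lemma bridge_path_confined_iff: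
  assumes C: "\<And>r z. 0 < r \<Longrightarrow> r *\<^sub>R z \<in> C \<longleftrightarrow> z \<in> C" and T: "0 < T"
  shows "(\<forall>u>0. bridge_path T v u \<in> C) \<longleftrightarrow> (\<forall>s\<in>{0<..<T}. v s \<in> C)"
proof -
  have "bridge_path T v u \<in> C \<longleftrightarrow> v (u * T / (u + T)) \<in> C" if "0 < u" for u
    unfolding bridge_path_def using T that by (intro C) auto
  then have "(\<forall>u>0. bridge_path T v u \<in> C) \<longleftrightarrow> (\<forall>u>0. v (u * T / (u + T)) \<in> C)" by auto
  also have "\<dots> \<longleftrightarrow> (\<forall>s\<in>{0<..<T}. v s \<in> C)"
  proof safe
    fix s assume *: "\<forall>u>0. v (u * T / (u + T)) \<in> C" and s: "s \<in> {0<..<T}"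
    let ?u = "s * T / (T - s)"
    have "?u > 0" "?u * T / (?u + T) = s" using s T by (auto simp: divide_simps algebra_simps)
    then show "v s \<in> C" using * by metis
  next
    fix u :: real assume *: "\<forall>s\<in>{0<..<T}. v s \<in> C" and "0 < u"
    then have "u * T / (u + T) \<in> {0<..<T}" using T by (auto simp: divide_simps algebra_simps)
    then show "v (u * T / (u + T)) \<in> C" using * by blast
  qed
  finally show ?thesis .
qed

lemma confinement_measurable:
  assumes X: "brownian_motion N X x c" and C: "open C" "C \<noteq> UNIV"
  shows "confinement N X c C \<in> borel_measurable borel"
proof -
  interpret N: prob_space N by (rule brownian_motionD(1)[OF X])
  let ?P = "PiM {0..} (\<lambda>_ :: real. borel :: (real ^ 'b) measure)"
  let ?x = "\<lambda>p. \<lambda>u\<in>{0..}. X u (snd p) + u *\<^sub>R (fst p - c)"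
  have [measurable]: "?x \<in> measurable (borel \<Otimes>\<^sub>M N) ?P"
    by (intro measurable_restrict) (use brownian_motionD(2)[OF X] in measurable)
  have "confinement N X c C y = (\<integral>\<^sup>+\<omega>. indicator (confined_paths C) (?x (y, \<omega>)) \<partial>N)" for y
  proof -
    have iff: "?x (y, \<omega>) \<in> confined_paths C \<longleftrightarrow> (\<forall>u>0. X u \<omega> + u *\<^sub>R (y - c) \<in> C)" if "\<omega> \<in> space N" for \<omega>
      using confined_paths_iff[OF C, of "\<lambda>u. X u \<omega> + u *\<^sub>R (y - c)"] brownian_motionD(3)[OF X that]
      by (simp add: continuous_intros)
    have "(\<lambda>\<omega>. ?x (y, \<omega>)) \<in> measurable N ?P" by measurable
    then have "{\<omega> \<in> space N. ?x (y, \<omega>) \<in> confined_paths C} \<in> sets N" by measurable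
    then have "emeasure N {\<omega> \<in> space N. ?x (y, \<omega>) \<in> confined_paths C} =
        (\<integral>\<^sup>+\<omega>. indicator {\<omega> \<in> space N. ?x (y, \<omega>) \<in> confined_paths C} \<omega> \<partial>N)"
      by (rule nn_integral_indicator[symmetric])
    also have "\<dots> = (\<integral>\<^sup>+\<omega>. indicator (confined_paths C) (?x (y, \<omega>)) \<partial>N)"
      by (rule nn_integral_cong) (simp split: split_indicator)
    finally have "emeasure N {\<omega> \<in> space N. ?x (y, \<omega>) \<in> confined_paths C} =
        (\<integral>\<^sup>+\<omega>. indicator (confined_paths C) (?x (y, \<omega>)) \<partial>N)" .
    moreover have "{\<omega> \<in> space N. ?x (y, \<omega>) \<in> confined_paths C} = {\<omega> \<in> space N. \<forall>u>0. X u \<omega> + u *\<^sub>R (y - c) \<in> C}"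
      using iff by auto
    ultimately show ?thesis unfolding confinement_def by simp
  qed
  then have "confinement N X c C = (\<lambda>y. \<integral>\<^sup>+\<omega>. indicator (confined_paths C) (?x (y, \<omega>)) \<partial>N)" by blast
  moreover have "\<dots> \<in> borel_measurable borel"
    by (rule N.borel_measurable_nn_integral_fst,
        rule measurable_compose[OF _ borel_measurable_indicator[OF confined_paths_measurable]]) fact
  ultimately show ?thesis by simp
qed

lemma confined_event_measurable:
  assumes X: "brownian_motion N X x c" and C: "open C" "C \<noteq> UNIV"
  shows "{\<omega> \<in> space N. \<forall>u>0. X u \<omega> \<in> C} \<in> sets N"
proof -
  let ?P = "PiM {0..} (\<lambda>_ :: real. borel :: (real ^ 'b) measure)"
  let ?x = "\<lambda>\<omega>. \<lambda>u\<in>{0..}. X u \<omega>"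
  have [measurable]: "?x \<in> measurable N ?P"
    by (intro measurable_restrict) (use brownian_motionD(2)[OF X] in measurable)
  have "{\<omega> \<in> space N. \<forall>u>0. X u \<omega> \<in> C} = {\<omega> \<in> space N. ?x \<omega> \<in> confined_paths C}"
    using confined_paths_iff[OF C] brownian_motionD(3)[OF X] by auto
  then show ?thesis by simp
qed

lemma confined_until_measurable:
  assumes X: "brownian_motion N X x c" and C: "open C" "C \<noteq> UNIV" and T: "0 < T"
  shows "{\<omega> \<in> space N. \<forall>s\<in>{0<..T}. X s \<omega> \<in> C} \<in> sets N"
proof -
  let ?P = "PiM {0..} (\<lambda>_ :: real. borel :: (real ^ 'b) measure)"
  let ?x = "\<lambda>\<omega>. \<lambda>u\<in>{0..}. X (min u T) \<omega>"
  have [measurable]: "?x \<in> measurable N ?P"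
    using T by (intro measurable_restrict brownian_motionD(2)[OF X]) auto
  have "?x \<omega> \<in> confined_paths C \<longleftrightarrow> (\<forall>s\<in>{0<..T}. X s \<omega> \<in> C)" if "\<omega> \<in> space N" for \<omega>
  proof -
    have "continuous_on {0..} (\<lambda>u. X (min u T) \<omega>)"
      using T by (intro continuous_on_compose2[OF brownian_motionD(3)[OF X that]] continuous_intros) auto
    from confined_paths_iff[OF C this]
    have "?x \<omega> \<in> confined_paths C \<longleftrightarrow> (\<forall>u>0. X (min u T) \<omega> \<in> C)" by simp
    also have "\<dots> \<longleftrightarrow> (\<forall>s\<in>{0<..T}. X s \<omega> \<in> C)"
      using T by (auto simp: min_def)
    finally show ?thesis .
  qed
  then have "{\<omega> \<in> space N. \<forall>s\<in>{0<..T}. X s \<omega> \<in> C} = {\<omega> \<in> space N. ?x \<omega> \<in> confined_paths C}"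
    by auto
  then show ?thesis by simp
qed

text \<open>The time inversion applied to confinement in a cone: conditioned on \<open>W T = y\<close>, not leaving the cone
  before time \<open>T\<close> has the same probability as never leaving it with drift \<open>y / T\<close>.\<close>

lemma confined_until_decomposition:
  assumes W: "brownian_motion M W x b" and X: "brownian_motion N X x c" and T: "0 < T"
    and C: "open C" "C \<noteq> UNIV" "\<And>r z. 0 < r \<Longrightarrow> r *\<^sub>R z \<in> C \<longleftrightarrow> z \<in> C"
    and A: "A \<in> sets borel" "A \<subseteq> C"
  shows "emeasure M {\<omega> \<in> space M. (\<forall>s\<in>{0<..T}. W s \<omega> \<in> C) \<and> W T \<omega> \<in> A} =
    (\<integral>\<^sup>+y\<in>A. ennreal (gauss_density (T *\<^sub>R b) T (y - x)) * confinement N X c C (y /\<^sub>R T) \<partial>lborel)"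
proof -
  have "{\<omega> \<in> space M. (\<forall>s\<in>{0<..T}. W s \<omega> \<in> C) \<and> W T \<omega> \<in> A} =
      {\<omega> \<in> space M. restrict (bridge_path T (\<lambda>t. W t \<omega>)) {0..} \<in> confined_paths C \<and> W T \<omega> \<in> A}"
  proof (rule Collect_cong, rule conj_cong[OF refl])
    fix \<omega> assume \<omega>: "\<omega> \<in> space M"
    have "restrict (bridge_path T (\<lambda>t. W t \<omega>)) {0..} \<in> confined_paths C \<longleftrightarrow> (\<forall>s\<in>{0<..<T}. W s \<omega> \<in> C)"
      using confined_paths_iff[OF C(1,2) continuous_on_bridge_path[OF brownian_motionD(3)[OF W \<omega>] T]]
        bridge_path_confined_iff[of C T "\<lambda>t. W t \<omega>", OF C(3) T] by simp
    moreover have "{0<..T} = insert T {0<..<T}" using T by auto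
    ultimately show "(\<forall>s\<in>{0<..T}. W s \<omega> \<in> C) \<and> W T \<omega> \<in> A \<longleftrightarrow>
        restrict (bridge_path T (\<lambda>t. W t \<omega>)) {0..} \<in> confined_paths C \<and> W T \<omega> \<in> A"
      using A by auto
  qed
  also have "emeasure M \<dots> = (\<integral>\<^sup>+y\<in>A. ennreal (gauss_density (T *\<^sub>R b) T (y - x)) *
        emeasure N {\<omega> \<in> space N. (\<lambda>u\<in>{0..}. X u \<omega> + u *\<^sub>R (y /\<^sub>R T - c)) \<in> confined_paths C} \<partial>lborel)"
    by (rule bridge_law[OF W X T A(1) confined_paths_measurable])
  also have "\<dots> = (\<integral>\<^sup>+y\<in>A. ennreal (gauss_density (T *\<^sub>R b) T (y - x)) * confinement N X c C (y /\<^sub>R T) \<partial>lborel)"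
  proof (intro nn_integral_cong)
    fix y
    have "{\<omega> \<in> space N. (\<lambda>u\<in>{0..}. X u \<omega> + u *\<^sub>R (y /\<^sub>R T - c)) \<in> confined_paths C} =
        {\<omega> \<in> space N. \<forall>u>0. X u \<omega> + u *\<^sub>R (y /\<^sub>R T - c) \<in> C}"
      using confined_paths_iff[OF C(1,2)] brownian_motionD(3)[OF X] by (auto simp: continuous_intros)
    then show "ennreal (gauss_density (T *\<^sub>R b) T (y - x)) *
        emeasure N {\<omega> \<in> space N. (\<lambda>u\<in>{0..}. X u \<omega> + u *\<^sub>R (y /\<^sub>R T - c)) \<in> confined_paths C} * indicator A y =
      ennreal (gauss_density (T *\<^sub>R b) T (y - x)) * confinement N X c C (y /\<^sub>R T) * indicator A y"
      by (simp add: confinement_def)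
  qed
  finally show ?thesis .
qed

section \<open>The law of large numbers\<close>

text \<open>Only rational times are tested, which makes this an event of the product space.\<close>

definition sublinear_paths :: "real \<Rightarrow> (real \<Rightarrow> 'a :: real_normed_vector) set" where
  "sublinear_paths e = {v \<in> space (PiM {0..} (\<lambda>_. borel)). \<exists>n::nat. \<forall>q\<in>\<rat> \<inter> {real n..}. norm (v q) \<le> e * q}"

lemma sublinear_paths_measurable [measurable]:
  "(sublinear_paths e :: (real \<Rightarrow> real ^ 'n) set) \<in> sets (PiM {0..} (\<lambda>_. borel))"
  unfolding sublinear_paths_def
proof (intro sets.sets_Collect_countable_Ex sets.sets_Collect_countable_All')
  fix n :: nat and q :: real
  assume "q \<in> \<rat> \<inter> {real n..}"
  then have "q \<in> {0..}"
    by (auto intro: order_trans[rotated])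
  then have [measurable]: "(\<lambda>v. v q) \<in> measurable (PiM {0..} (\<lambda>_. borel)) borel"
    by (rule measurable_component_singleton)
  show "{v \<in> space (PiM {0..} (\<lambda>_. borel :: (real ^ 'n) measure)). norm (v q) \<le> e * q} \<in> sets (PiM {0..} (\<lambda>_. borel))"
    by measurable
qed (auto intro: countable_subset[OF _ countable_rat])

lemma restrict_in_sublinear_paths_iff:
  "restrict v {0..} \<in> sublinear_paths e \<longleftrightarrow> (\<exists>n::nat. \<forall>q\<in>\<rat> \<inter> {real n..}. norm (v q) \<le> e * q)"
proof -
  have "(\<forall>q\<in>\<rat> \<inter> {real n..}. norm (restrict v {0..} q) \<le> e * q) \<longleftrightarrow>
      (\<forall>q\<in>\<rat> \<inter> {real n..}. norm (v q) \<le> e * q)" for n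
  proof (rule ball_cong)
    fix q assume "q \<in> \<rat> \<inter> {real n..}"
    then have "0 \<le> q" by (auto intro: order_trans[rotated])
    then show "norm (restrict v {0..} q) \<le> e * q \<longleftrightarrow> norm (v q) \<le> e * q" by simp
  qed simp
  moreover have "restrict v {0..} \<in> space (PiM {0..} (\<lambda>_. borel))" by (simp add: space_PiM)
  ultimately show ?thesis unfolding sublinear_paths_def mem_Collect_eq by simp
qed

text \<open>The inverted path at a late time \<open>u\<close> is about \<open>u\<close> times the value of the original path just before
  time \<open>1\<close>. Continuity of the original path at \<open>1\<close> thus bounds the growth of the inverted one.\<close>

lemma bridge_path_sublinear:
  fixes v :: "real \<Rightarrow> 'a :: real_normed_vector"
  assumes v: "continuous_on {0..} v" and e: "norm (v 1) < e"
  shows "restrict (bridge_path 1 v) {0..} \<in> sublinear_paths (2 * e)"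
proof -
  have "((\<lambda>u::real. u / (u + 1)) \<longlongrightarrow> 1) at_top"
    by real_asymp
  moreover have "isCont v 1"
    using v by (rule continuous_on_interior) simp
  ultimately have "((\<lambda>u::real. v (u / (u + 1))) \<longlongrightarrow> v 1) at_top"
    using isCont_tendsto_compose by blast
  then have "((\<lambda>u::real. norm (v (u / (u + 1)))) \<longlongrightarrow> norm (v 1)) at_top"
    by (rule tendsto_norm)
  then have "\<forall>\<^sub>F u::real in at_top. norm (v (u / (u + 1))) < e"
    using e by (rule order_tendstoD)
  then obtain U :: real where U: "\<And>u. U \<le> u \<Longrightarrow> norm (v (u / (u + 1))) < e"
    unfolding eventually_at_top_linorder by blast
  obtain n :: nat where n: "max 1 U \<le> real n" using real_arch_simple by blast
  have e0: "0 < e" using e norm_ge_zero[of "v 1"] by linarith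
  have "norm (bridge_path 1 v q) \<le> 2 * e * q" if "real n \<le> q" for q
  proof -
    have q: "1 \<le> q" "U \<le> q" using that n by auto
    have "norm (bridge_path 1 v q) = (q + 1) * norm (v (q / (q + 1)))"
      using q by (simp add: bridge_path_def)
    also have "\<dots> \<le> (2 * q) * e"
      using q e0 less_imp_le[OF U[OF q(2)]] by (intro mult_mono) auto
    finally show ?thesis by (simp add: mult_ac)
  qed
  then show ?thesis unfolding restrict_in_sublinear_paths_iff by (intro exI[of _ n]) auto
qed

lemma gauss_density_pos: "0 < v \<Longrightarrow> 0 < gauss_density m v y"
  unfolding gauss_density_def by (intro divide_pos_pos) auto

lemma open_emeasure_lborel_pos:
  fixes S :: "'a :: euclidean_space set"
  assumes "open S" "S \<noteq> {}"
  shows "emeasure lborel S \<noteq> 0"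
proof -
  obtain z e where z: "0 < e" "ball z e \<subseteq> S"
    using assms open_contains_ball by blast
  have "measure lborel (ball z e) > 0" using content_ball_pos[OF z(1), of z] by simp
  then have "emeasure lborel (ball z e) \<noteq> 0" by (auto simp: measure_def)
  moreover have "emeasure lborel (ball z e) \<le> emeasure lborel S"
    using z assms by (intro emeasure_mono) auto
  ultimately show ?thesis by auto
qed

text \<open>Let \<open>\<rho>\<close> be the probability in question and \<open>G\<close> the probability that \<open>X 1\<close> lies in the ball of radius
  \<open>e\<close>. On that event the inverted path grows at rate at most \<open>2 e\<close>, as \<open>X\<close> is continuous at time \<open>1\<close>.
  By time inversion \<open>G\<close> is then an integral over drifts \<open>y\<close> in the ball of the probability that the
  motion with drift \<open>y\<close> grows at that rate, which is at most \<open>\<rho>\<close>. Hence \<open>G \<le> G \<rho>\<close>, and \<open>G > 0\<close>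
  gives \<open>\<rho> = 1\<close>.\<close>

lemma brownian_motion_sublinear_AE:
  assumes X: "brownian_motion N X x c" and e: "0 < e"
  shows "AE \<omega> in N. (\<lambda>u\<in>{0..}. X u \<omega> - u *\<^sub>R c) \<in> sublinear_paths (3 * e)"
proof -
  interpret N: prob_space N by (rule brownian_motionD(1)[OF X])
  let ?P = "PiM {0..} (\<lambda>_ :: real. borel :: (real ^ 'b) measure)"
  let ?x = "\<lambda>y \<omega>. \<lambda>u\<in>{0..}. X u \<omega> + u *\<^sub>R (y - c)"
  let ?S = "\<lambda>y d. {\<omega> \<in> space N. ?x y \<omega> \<in> sublinear_paths d}"
  let ?g = "\<lambda>y. ennreal (gauss_density (1 *\<^sub>R c) 1 (y - x)) * indicator (ball 0 e) y"
  have meas: "?x y \<in> measurable N ?P" for y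
    by (intro measurable_restrict) (use brownian_motionD(2)[OF X] in measurable)
  have [measurable]: "ball (0 :: real ^ 'b) e \<in> sets borel" by simp
  have sets: "?S y d \<in> sets N" for y d using meas[of y] by measurable
  let ?\<rho> = "emeasure N (?S 0 (3 * e))"
  have le: "emeasure N (?S y (2 * e)) \<le> ?\<rho>" if "y \<in> ball 0 e" for y
  proof (rule emeasure_mono[OF _ sets], safe)
    fix \<omega> assume "?x y \<omega> \<in> sublinear_paths (2 * e)"
    then obtain n :: nat where n: "\<And>q. q \<in> \<rat> \<inter> {real n..} \<Longrightarrow> norm (X q \<omega> + q *\<^sub>R (y - c)) \<le> 2 * e * q"
      unfolding restrict_in_sublinear_paths_iff by blast
    have "norm (X q \<omega> + q *\<^sub>R (0 - c)) \<le> 3 * e * q" if q: "q \<in> \<rat> \<inter> {real n..}" for q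
    proof -
      have q0: "0 \<le> q" using q by (auto intro: order_trans[rotated])
      have "X q \<omega> + q *\<^sub>R (0 - c) = (X q \<omega> + q *\<^sub>R (y - c)) - q *\<^sub>R y" by (simp add: algebra_simps)
      then have "norm (X q \<omega> + q *\<^sub>R (0 - c)) \<le> norm (X q \<omega> + q *\<^sub>R (y - c)) + norm (q *\<^sub>R y)"
        by (metis norm_triangle_ineq4)
      also have "norm (q *\<^sub>R y) \<le> q * e" using q0 that \<open>y \<in> ball 0 e\<close> by (simp add: mult_left_mono)
      finally show ?thesis using n[OF q] by (simp add: algebra_simps)
    qed
    then show "?x 0 \<omega> \<in> sublinear_paths (3 * e)"
      unfolding restrict_in_sublinear_paths_iff by blast
  qed
  have bridge: "{\<omega> \<in> space N. restrict (bridge_path 1 (\<lambda>t. X t \<omega>)) {0..} \<in> sublinear_paths (2 * e) \<and> X 1 \<omega> \<in> ball 0 e} =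
      {\<omega> \<in> space N. restrict (bridge_path 1 (\<lambda>t. X t \<omega>)) {0..} \<in> space ?P \<and> X 1 \<omega> \<in> ball 0 e}"
    using bridge_path_sublinear[OF brownian_motionD(3)[OF X]] by (auto simp: space_PiM)
  have "(\<integral>\<^sup>+y. ?g y \<partial>lborel) = emeasure N {\<omega> \<in> space N. restrict (bridge_path 1 (\<lambda>t. X t \<omega>)) {0..} \<in> space ?P \<and> X 1 \<omega> \<in> ball 0 e}"
    using bridge_law[OF X X zero_less_one _ sets.top, of "ball 0 e"]
    by (simp add: space_PiM N.emeasure_space_1)
  also have "\<dots> = (\<integral>\<^sup>+y\<in>ball 0 e. ennreal (gauss_density (1 *\<^sub>R c) 1 (y - x)) * emeasure N (?S y (2 * e)) \<partial>lborel)"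
    unfolding bridge[symmetric]
    using bridge_law[OF X X zero_less_one _ sublinear_paths_measurable, of "ball 0 e" "2 * e"] by simp
  also have "\<dots> \<le> (\<integral>\<^sup>+y. ?g y * ?\<rho> \<partial>lborel)"
  proof (intro nn_integral_mono)
    fix y
    show "ennreal (gauss_density (1 *\<^sub>R c) 1 (y - x)) * emeasure N (?S y (2 * e)) * indicator (ball 0 e) y \<le> ?g y * ?\<rho>"
      using le[of y] by (auto split: split_indicator intro!: mult_left_mono)
  qed
  also have "\<dots> = (\<integral>\<^sup>+y. ?g y \<partial>lborel) * ?\<rho>"
    by (rule nn_integral_multc) simp
  finally have main: "(\<integral>\<^sup>+y. ?g y \<partial>lborel) \<le> (\<integral>\<^sup>+y. ?g y \<partial>lborel) * ?\<rho>" .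
  have "(\<integral>\<^sup>+y. ?g y \<partial>lborel) \<noteq> 0"
  proof
    assume "(\<integral>\<^sup>+y. ?g y \<partial>lborel) = 0"
    then have "AE y in lborel. ?g y = 0" by (subst (asm) nn_integral_0_iff_AE) auto
    then have "AE y in lborel. y \<notin> ball (0 :: real ^ 'b) e"
    proof eventually_elim
      case (elim y)
      then show ?case
        using gauss_density_pos[of 1 "1 *\<^sub>R c" "y - x"] by (auto split: split_indicator_asm)
    qed
    then have "emeasure lborel (ball (0 :: real ^ 'b) e) = 0"
      by (subst (asm) AE_iff_measurable[of "ball 0 e"]) auto
    then show False using open_emeasure_lborel_pos[of "ball (0 :: real ^ 'b) e"] e by auto
  qed
  moreover have "(\<integral>\<^sup>+y. ?g y \<partial>lborel) \<noteq> \<infinity>"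
  proof -
    have "(\<integral>\<^sup>+y. ?g y \<partial>lborel) \<le> (\<integral>\<^sup>+y. ennreal (gauss_density (1 *\<^sub>R c) 1 (y - x)) \<partial>lborel)"
      by (intro nn_integral_mono) (auto split: split_indicator)
    also have "\<dots> = 1" by (rule nn_integral_gauss_density[OF X zero_less_one])
    finally show ?thesis by (auto simp: top_unique)
  qed
  ultimately have "1 \<le> ?\<rho>"
    using main ennreal_mult_le_mult_iff[of "\<integral>\<^sup>+y. ?g y \<partial>lborel" 1 ?\<rho>] by simp
  then have "emeasure N (?S 0 (3 * e)) = 1"
    using N.emeasure_le_1 by (intro antisym) auto
  then have "AE \<omega> in N. \<omega> \<in> ?S 0 (3 * e)"
    by (intro N.AE_in_set_eq_1[THEN iffD2] sets) (simp_all add: measure_def)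
  then show ?thesis by eventually_elim simp
qed

lemma brownian_motion_lln:
  assumes X: "brownian_motion N X x c"
  shows "AE \<omega> in N. \<forall>e>0. \<exists>U>0. \<forall>u\<ge>U. norm (X u \<omega> - u *\<^sub>R c) \<le> e * u"
proof -
  have "AE \<omega> in N. (\<lambda>u\<in>{0..}. X u \<omega> - u *\<^sub>R c) \<in> sublinear_paths (1 / (real j + 1))" for j :: nat
  proof -
    have "AE \<omega> in N. (\<lambda>u\<in>{0..}. X u \<omega> - u *\<^sub>R c) \<in> sublinear_paths (3 * (1 / (real j + 1) / 3))"
      by (rule brownian_motion_sublinear_AE[OF X]) simp
    moreover have "3 * (z / 3) = z" for z :: real by simp
    ultimately show ?thesis by (simp only:)
  qed
  then have "AE \<omega> in N. \<forall>j::nat. (\<lambda>u\<in>{0..}. X u \<omega> - u *\<^sub>R c) \<in> sublinear_paths (1 / (real j + 1))"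
    by (simp add: AE_all_countable)
  then show ?thesis
    using AE_space
  proof eventually_elim
    case (elim \<omega>)
    show ?case
    proof (intro allI impI)
      fix e :: real assume "0 < e"
      then obtain j :: nat where j: "1 / (real j + 1) < e"
        using reals_Archimedean[of e] by (auto simp: inverse_eq_divide add.commute)
      obtain n :: nat where n: "\<And>q. q \<in> \<rat> \<inter> {real n..} \<Longrightarrow> norm (X q \<omega> - q *\<^sub>R c) \<le> 1 / (real j + 1) * q"
        using elim(1) unfolding restrict_in_sublinear_paths_iff by blast
      have "norm (X u \<omega> - u *\<^sub>R c) \<le> e * u" if u: "real n + 1 \<le> u" for u
      proof -
        have "0 \<le> 1 / (real j + 1) * u - norm (X u \<omega> - u *\<^sub>R c)"
        proof (rule continuous_ge_if_rationals_ge[where a="real n" and b=u and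
              f="\<lambda>u. 1 / (real j + 1) * u - norm (X u \<omega> - u *\<^sub>R c)"])
          show "continuous_on {real n..u} (\<lambda>u. 1 / (real j + 1) * u - norm (X u \<omega> - u *\<^sub>R c))"
            using brownian_motionD(3)[OF X elim(2)]
            by (intro continuous_intros) (auto intro: continuous_on_subset)
          show "0 \<le> 1 / (real j + 1) * q - norm (X q \<omega> - q *\<^sub>R c)" if "q \<in> \<rat>" "q \<in> {real n..u}" for q
            using n[of q] that by auto
        qed (use u in auto)
        moreover have "1 / (real j + 1) * u \<le> e * u" using j u by (intro mult_right_mono) auto
        ultimately show ?thesis by linarith
      qed
      then show "\<exists>U>0. \<forall>u\<ge>U. norm (X u \<omega> - u *\<^sub>R c) \<le> e * u"
        by (intro exI[of _ "real n + 1"]) auto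
    qed
  qed
qed

section \<open>Continuity in the drift\<close>

text \<open>If the motion with drift \<open>a\<close> stays in the cone, then almost surely so does the motion with any
  sufficiently close drift. At late times the path divided by the time is close to the drift, which
  is an interior point of the cone; at early times the path is a compact subset of the open cone.
  Fatou's lemma turns this into a statement on probabilities.\<close>

lemma confinement_lsc:
  assumes X: "brownian_motion N X x c" and x: "x \<in> C"
    and C: "open C" "C \<noteq> UNIV" "\<And>r z. 0 < r \<Longrightarrow> r *\<^sub>R z \<in> C \<longleftrightarrow> z \<in> C"
    and a: "a \<in> C" and y: "y \<longlonglongrightarrow> a"
  shows "confinement N X c C a \<le> liminf (\<lambda>n. confinement N X c C (y n))"
proof -
  let ?E = "\<lambda>y. {\<omega> \<in> space N. \<forall>u>0. X u \<omega> + u *\<^sub>R (y - c) \<in> C}"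
  have sets [measurable]: "?E z \<in> sets N" for z
    by (rule confined_event_measurable[OF brownian_motion_add_drift[OF X] C(1,2)])
  have "AE \<omega> in N. indicator (?E a) \<omega> \<le> liminf (\<lambda>n. indicator (?E (y n)) \<omega> :: ennreal)"
    using brownian_motion_lln[OF X] brownian_motionD(4)[OF X] AE_space
  proof eventually_elim
    case (elim \<omega>)
    show ?case
    proof (cases "\<omega> \<in> ?E a")
      case True
      let ?p = "\<lambda>z u. X u \<omega> + u *\<^sub>R (z - c)"
      have p0: "?p a u \<in> C" if "0 \<le> u" for u
        using True that elim(2) x by (cases "u = 0") auto
      obtain \<delta> where \<delta>: "0 < \<delta>" "ball a (2 * \<delta>) \<subseteq> C"
      proof -
        obtain e where "0 < e" "ball a e \<subseteq> C" using C(1) a open_contains_ball by blast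
        then show ?thesis using that[of "e / 2"] by simp
      qed
      obtain U where U: "0 < U" "\<And>u. U \<le> u \<Longrightarrow> norm (X u \<omega> - u *\<^sub>R c) \<le> \<delta> * u"
        using elim(1) \<delta>(1) by blast
      have far: "?p z u \<in> C" if z: "dist z a < \<delta>" and u: "U \<le> u" for z u
      proof -
        have u0: "0 < u" using u U by simp
        let ?d = "inverse u *\<^sub>R (X u \<omega> - u *\<^sub>R c)"
        have "norm ?d \<le> \<delta>" using U(2)[OF u] u0 by (simp add: divide_simps mult.commute)
        moreover have "dist z (z + ?d) = norm ?d" by (simp add: dist_norm)
        ultimately have "dist a (z + ?d) < 2 * \<delta>"
          using z dist_triangle[of a "z + ?d" z] by (simp add: dist_commute)
        then have "z + ?d \<in> C" using \<delta> by auto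
        moreover have "?p z u = u *\<^sub>R (z + ?d)" using u0 by (simp add: algebra_simps)
        ultimately show ?thesis using C(3)[OF u0] by simp
      qed
      have cont: "continuous_on {0..U} (?p a)"
        using brownian_motionD(3)[OF X elim(3)] by (intro continuous_intros) (auto intro: continuous_on_subset)
      obtain \<eta> where \<eta>: "0 < \<eta>" "\<And>u z. u \<in> {0..U} \<Longrightarrow> dist z (?p a u) < \<eta> \<Longrightarrow> z \<in> C"
      proof -
        have "compact (?p a ` {0..U})" by (rule compact_continuous_image[OF cont compact_Icc])
        moreover have "?p a ` {0..U} \<subseteq> C" using p0 by auto
        ultimately obtain e where e: "0 < e" "(\<Union>z\<in>?p a ` {0..U}. cball z e) \<subseteq> C"
          using compact_subset_open_imp_cball_epsilon_subset[OF _ C(1)] by metis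
        show ?thesis
        proof (rule that[OF e(1)])
          fix u z assume "u \<in> {0..U}" "dist z (?p a u) < e"
          then have "z \<in> cball (?p a u) e" by (simp add: dist_commute)
          then show "z \<in> C" using e(2) \<open>u \<in> {0..U}\<close> by blast
        qed
      qed
      have near: "?p z u \<in> C" if z: "dist z a < \<eta> / U" and u: "0 < u" "u \<le> U" for z u
      proof -
        have "dist (?p z u) (?p a u) = u * dist z a"
          using u by (simp add: dist_norm scaleR_diff_right[symmetric])
        also have "\<dots> \<le> U * dist z a" using u by (intro mult_right_mono) auto
        also have "\<dots> < \<eta>" using z U by (simp add: field_simps)
        finally show ?thesis using \<eta>(2)[of u "?p z u"] u by simp
      qed
      have "\<forall>\<^sub>F n in sequentially. dist (y n) a < min \<delta> (\<eta> / U)"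
        using y \<delta>(1) \<eta>(1) U(1) by (intro tendstoD) auto
      then have "\<forall>\<^sub>F n in sequentially. (1 :: ennreal) \<le> indicator (?E (y n)) \<omega>"
      proof eventually_elim
        case n: (elim n)
        have "?p (y n) u \<in> C" if "0 < u" for u
          using far[of "y n" u] near[of "y n" u] n that by (cases "u \<le> U") auto
        then show ?case using elim(3) by simp
      qed
      then have "(1 :: ennreal) \<le> liminf (\<lambda>n. indicator (?E (y n)) \<omega>)"
        by (rule Liminf_bounded)
      then show ?thesis using True by simp
    qed simp
  qed
  then have "(\<integral>\<^sup>+\<omega>. indicator (?E a) \<omega> \<partial>N) \<le> (\<integral>\<^sup>+\<omega>. liminf (\<lambda>n. indicator (?E (y n)) \<omega>) \<partial>N)"
    by (rule nn_integral_mono_AE)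
  also have "\<dots> \<le> liminf (\<lambda>n. \<integral>\<^sup>+\<omega>. indicator (?E (y n)) \<omega> \<partial>N)"
    by (rule nn_integral_liminf) simp
  finally show ?thesis by (simp add: confinement_def)
qed

text \<open>The event of leaving before time \<open>T\<close> depends on the drift \<open>y\<close> only through the Gaussian density of the
  position at time \<open>T\<close>.\<close>

lemma exit_until_density:
  assumes X: "brownian_motion N X x c" and T: "0 < T"
    and C: "open C" "C \<noteq> UNIV" "\<And>r z. 0 < r \<Longrightarrow> r *\<^sub>R z \<in> C \<longleftrightarrow> z \<in> C"
  shows "emeasure N {\<omega> \<in> space N. \<not> (\<forall>s\<in>{0<..T}. X s \<omega> + s *\<^sub>R (y - c) \<in> C)} =
    (\<integral>\<^sup>+z. ennreal (gauss_density (T *\<^sub>R y) T (z - x)) *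
       (1 - indicator C z * confinement N X c C (z /\<^sub>R T)) \<partial>lborel)"
proof -
  interpret N: prob_space N by (rule brownian_motionD(1)[OF X])
  have Y: "brownian_motion N (\<lambda>t \<omega>. X t \<omega> + t *\<^sub>R (y - c)) x y"
    using brownian_motion_add_drift[OF X, of "y - c"] by simp
  let ?E = "{\<omega> \<in> space N. \<forall>s\<in>{0<..T}. X s \<omega> + s *\<^sub>R (y - c) \<in> C}"
  let ?g = "\<lambda>z. ennreal (gauss_density (T *\<^sub>R y) T (z - x))"
  let ?k = "\<lambda>z. indicator C z * confinement N X c C (z /\<^sub>R T)"
  note [measurable] = confinement_measurable[OF X C(1,2)] borel_open[OF C(1)]
  have E: "?E \<in> sets N"
    by (rule confined_until_measurable[OF Y C(1,2) T])
  have k1: "?k z \<le> 1" for z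
    unfolding confinement_def using N.emeasure_le_1 by (auto split: split_indicator)
  have "?E = {\<omega> \<in> space N. (\<forall>s\<in>{0<..T}. X s \<omega> + s *\<^sub>R (y - c) \<in> C) \<and> X T \<omega> + T *\<^sub>R (y - c) \<in> C}"
    using T by auto
  then have stay: "emeasure N ?E = (\<integral>\<^sup>+z. ?g z * ?k z \<partial>lborel)"
    using confined_until_decomposition[OF Y X T C borel_open[OF C(1)] order_refl] by (simp add: mult_ac)
  have "(\<integral>\<^sup>+z. ?g z * ?k z \<partial>lborel) + (\<integral>\<^sup>+z. ?g z * (1 - ?k z) \<partial>lborel) = (\<integral>\<^sup>+z. ?g z \<partial>lborel)"
  proof -
    have "?g z * ?k z + ?g z * (1 - ?k z) = ?g z" for z
    proof -
      have "?g z * ?k z + ?g z * (1 - ?k z) = ?g z * (?k z + (1 - ?k z))" by (rule distrib_left[symmetric])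
      then show ?thesis unfolding add_diff_inverse_ennreal[OF k1] by simp
    qed
    moreover have "(\<integral>\<^sup>+z. ?g z * ?k z \<partial>lborel) + (\<integral>\<^sup>+z. ?g z * (1 - ?k z) \<partial>lborel) =
        (\<integral>\<^sup>+z. ?g z * ?k z + ?g z * (1 - ?k z) \<partial>lborel)"
      by (rule nn_integral_add[symmetric]) measurable
    ultimately show ?thesis by (simp only:)
  qed
  also have "\<dots> = 1"
    by (rule nn_integral_gauss_density[OF Y T])
  finally have sum: "emeasure N ?E + (\<integral>\<^sup>+z. ?g z * (1 - ?k z) \<partial>lborel) = 1" using stay by simp
  have "emeasure N ?E + emeasure N (space N - ?E) = 1"
    unfolding N.emeasure_eq_measure N.prob_compl[OF E]
    by (subst ennreal_plus[symmetric]) (auto simp: N.prob_le_1)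
  with sum have "emeasure N ?E + emeasure N (space N - ?E) =
      emeasure N ?E + (\<integral>\<^sup>+z. ?g z * (1 - ?k z) \<partial>lborel)"
    by (simp only:)
  then have "emeasure N (space N - ?E) = (\<integral>\<^sup>+z. ?g z * (1 - ?k z) \<partial>lborel)"
    unfolding ennreal_add_left_cancel infinity_ennreal_def using N.emeasure_finite[of ?E] by blast
  moreover have "space N - ?E = {\<omega> \<in> space N. \<not> (\<forall>s\<in>{0<..T}. X s \<omega> + s *\<^sub>R (y - c) \<in> C)}"
    by auto
  ultimately show ?thesis by simp
qed

text \<open>For a fixed time \<open>T\<close>, Fatou's lemma applied to the previous formula shows that the probability of
  leaving before \<open>T\<close> is lower semicontinuous in the drift; the probability of ever leaving is the
  supremum of these over \<open>T\<close>. Comparing paths directly would not do here, since a path may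
  touch the boundary while its small perturbations avoid it.\<close>

lemma exit_lsc:
  assumes X: "brownian_motion N X x c"
    and C: "open C" "C \<noteq> UNIV" "\<And>r z. 0 < r \<Longrightarrow> r *\<^sub>R z \<in> C \<longleftrightarrow> z \<in> C"
    and y: "y \<longlonglongrightarrow> a"
  shows "emeasure N {\<omega> \<in> space N. \<not> (\<forall>u>0. X u \<omega> + u *\<^sub>R (a - c) \<in> C)} \<le>
    liminf (\<lambda>n. emeasure N {\<omega> \<in> space N. \<not> (\<forall>u>0. X u \<omega> + u *\<^sub>R (y n - c) \<in> C)})"
proof -
  interpret N: prob_space N by (rule brownian_motionD(1)[OF X])
  let ?D = "\<lambda>T y. {\<omega> \<in> space N. \<not> (\<forall>s\<in>{0<..T}. X s \<omega> + s *\<^sub>R (y - c) \<in> C)}"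
  let ?D_ever = "\<lambda>y. {\<omega> \<in> space N. \<not> (\<forall>u>0. X u \<omega> + u *\<^sub>R (y - c) \<in> C)}"
  let ?g = "\<lambda>T y z. ennreal (gauss_density (T *\<^sub>R y) T (z - x))"
  let ?k = "\<lambda>T z. indicator C z * confinement N X c C (z /\<^sub>R T)"
  note [measurable] = confinement_measurable[OF X C(1,2)] borel_open[OF C(1)]
  have Y: "brownian_motion N (\<lambda>t \<omega>. X t \<omega> + t *\<^sub>R (z - c)) x (c + (z - c))" for z
    by (rule brownian_motion_add_drift[OF X])
  have D: "?D T z \<in> sets N" if "0 < T" for T z
  proof -
    have "?D T z = space N - {\<omega> \<in> space N. \<forall>s\<in>{0<..T}. X s \<omega> + s *\<^sub>R (z - c) \<in> C}" by auto
    then show ?thesis using confined_until_measurable[OF Y C(1,2) that] by simp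
  qed
  have D_ever: "?D_ever z \<in> sets N" for z
  proof -
    have "?D_ever z = space N - {\<omega> \<in> space N. \<forall>u>0. X u \<omega> + u *\<^sub>R (z - c) \<in> C}" by auto
    then show ?thesis using confined_event_measurable[OF Y C(1,2)] by simp
  qed
  have T: "emeasure N (?D T a) \<le> liminf (\<lambda>n. emeasure N (?D_ever (y n)))" if T: "0 < T" for T
  proof -
    have lim: "(\<lambda>n. ?g T (y n) z * (1 - ?k T z)) \<longlonglongrightarrow> ?g T a z * (1 - ?k T z)" for z
    proof -
      have "1 - ?k T z \<le> 1" by (rule ennreal_diff_le_mono_left) simp
      then obtain r where r: "0 \<le> r" "1 - ?k T z = ennreal r"
        by (cases "1 - ?k T z") (auto simp: top_unique)
      have "(\<lambda>n. gauss_density (T *\<^sub>R y n) T (z - x) * r) \<longlonglongrightarrow> gauss_density (T *\<^sub>R a) T (z - x) * r"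
        unfolding gauss_density_def using y T by (intro tendsto_intros) auto
      then have "(\<lambda>n. ennreal (gauss_density (T *\<^sub>R y n) T (z - x) * r)) \<longlonglongrightarrow>
          ennreal (gauss_density (T *\<^sub>R a) T (z - x) * r)"
        by (rule tendsto_ennrealI)
      then show ?thesis by (simp add: r ennreal_mult' gauss_density_nonneg)
    qed
    have "emeasure N (?D T a) = (\<integral>\<^sup>+z. ?g T a z * (1 - ?k T z) \<partial>lborel)"
      by (rule exit_until_density[OF X T C])
    also have "\<dots> = (\<integral>\<^sup>+z. liminf (\<lambda>n. ?g T (y n) z * (1 - ?k T z)) \<partial>lborel)"
      by (intro nn_integral_cong lim_imp_Liminf[symmetric] lim) simp
    also have "\<dots> \<le> liminf (\<lambda>n. \<integral>\<^sup>+z. ?g T (y n) z * (1 - ?k T z) \<partial>lborel)"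
      by (rule nn_integral_liminf) measurable
    also have "\<dots> = liminf (\<lambda>n. emeasure N (?D T (y n)))"
      by (simp only: exit_until_density[OF X T C])
    also have "\<dots> \<le> liminf (\<lambda>n. emeasure N (?D_ever (y n)))"
      by (intro Liminf_mono always_eventually allI emeasure_mono D_ever) auto
    finally show ?thesis .
  qed
  have "emeasure N (?D_ever a) = (SUP n. emeasure N (?D (real (Suc n)) a))"
  proof -
    have "?D_ever a = (\<Union>n. ?D (real (Suc n)) a)"
    proof (intro set_eqI iffI)
      fix \<omega> assume "\<omega> \<in> ?D_ever a"
      then obtain u where u: "\<omega> \<in> space N" "0 < u" "X u \<omega> + u *\<^sub>R (a - c) \<notin> C" by auto
      obtain n :: nat where "u \<le> real n" using real_arch_simple by blast
      then have "u \<in> {0<..real (Suc n)}" using u by auto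
      then show "\<omega> \<in> (\<Union>n. ?D (real (Suc n)) a)" using u by blast
    qed auto
    moreover have "incseq (\<lambda>n. ?D (real (Suc n)) a)"
      unfolding incseq_def by fastforce
    ultimately show ?thesis
      using D by (subst SUP_emeasure_incseq) auto
  qed
  also have "\<dots> \<le> liminf (\<lambda>n. emeasure N (?D_ever (y n)))"
    by (intro SUP_least T) simp
  finally show ?thesis .
qed

section \<open>The survival probability\<close>

lemma survival_tendsto:
  assumes X: "brownian_motion N X x c" and C: "open C" "C \<noteq> UNIV"
  shows "((\<lambda>t :: real. measure N {\<omega> \<in> space N. exit_time C (\<lambda>s. X s \<omega>) > ereal t})
        \<longlongrightarrow> measure N {\<omega> \<in> space N. exit_time C (\<lambda>s. X s \<omega>) = \<infinity>}) at_top"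
proof -
  interpret N: prob_space N by (rule brownian_motionD(1)[OF X])
  let ?E = "\<lambda>t::real. {\<omega> \<in> space N. exit_time C (\<lambda>s. X s \<omega>) > ereal t}"
  let ?E_ever = "{\<omega> \<in> space N. exit_time C (\<lambda>s. X s \<omega>) = \<infinity>}"
  have E: "?E t \<in> sets N" if "0 < t" for t
  proof -
    have "?E t = {\<omega> \<in> space N. \<forall>s\<in>{0<..t}. X s \<omega> \<in> C}"
      using less_exit_time_iff[OF C(1) brownian_motionD(3)[OF X] that] by auto
    then show ?thesis using confined_until_measurable[OF X C that] by simp
  qed
  have E_ever: "?E_ever \<in> sets N"
    unfolding exit_time_eq_infinity_iff by (rule confined_event_measurable[OF X C])
  have mono: "?E t \<subseteq> ?E s" if "s \<le> t" for s t
    using that by (auto intro: le_less_trans[rotated])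
  have "(\<lambda>n. measure N (?E (real (Suc n)))) \<longlonglongrightarrow> measure N (\<Inter>n. ?E (real (Suc n)))"
    by (rule N.finite_Lim_measure_decseq) (use E mono in \<open>auto simp: decseq_def\<close>)
  also have "(\<Inter>n. ?E (real (Suc n))) = ?E_ever"
  proof (intro set_eqI iffI)
    fix \<omega> assume \<omega>: "\<omega> \<in> (\<Inter>n. ?E (real (Suc n)))"
    have "exit_time C (\<lambda>s. X s \<omega>) = \<infinity>"
    proof (rule ereal_top)
      fix r
      obtain n :: nat where "r \<le> real n" using real_arch_simple by blast
      then have "ereal r \<le> ereal (real (Suc n))" by simp
      also have "\<dots> \<le> exit_time C (\<lambda>s. X s \<omega>)" using \<omega> by (auto intro: less_imp_le)
      finally show "ereal r \<le> exit_time C (\<lambda>s. X s \<omega>)" .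
    qed
    then show "\<omega> \<in> ?E_ever" using \<omega> by auto
  qed auto
  finally have "(\<lambda>n. measure N (?E (real n))) \<longlonglongrightarrow> measure N ?E_ever"
    by (rule LIMSEQ_imp_Suc)
  then have upper: "((\<lambda>t::real. measure N (?E (real (nat \<lfloor>t\<rfloor>)))) \<longlongrightarrow> measure N ?E_ever) at_top"
    by (rule filterlim_compose) (rule filterlim_compose[OF filterlim_nat_sequentially filterlim_floor_sequentially])
  show ?thesis
  proof (rule tendsto_sandwich[OF _ _ tendsto_const upper])
    show "\<forall>\<^sub>F t in at_top. measure N ?E_ever \<le> measure N (?E t)"
      using eventually_gt_at_top[of 0]
      by eventually_elim (intro N.finite_measure_mono E, auto)
    show "\<forall>\<^sub>F t in at_top. measure N (?E t) \<le> measure N (?E (real (nat \<lfloor>t\<rfloor>)))"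
      using eventually_ge_at_top[of 1]
      by eventually_elim (intro N.finite_measure_mono E mono, linarith+)
  qed
qed

text \<open>Time inversion with \<open>T = 1\<close> and \<open>b = 0\<close> gives one density of the killed motion at time \<open>1\<close>; the kernel is
  another, so the two agree up to a null set.\<close>

lemma killed_density_eq_confinement_AE:
  fixes W :: "real \<Rightarrow> 'v \<Rightarrow> real ^ 'n"
  assumes W: "brownian_motion (Q x) W x 0" and kernel: "killed_transition_density Q W C p"
    and X: "brownian_motion N X x c" and x: "x \<in> C"
    and C: "open C" "C \<noteq> UNIV" "\<And>r z. 0 < r \<Longrightarrow> r *\<^sub>R z \<in> C \<longleftrightarrow> z \<in> C"
  shows "AE y in lborel. y \<in> C \<longrightarrow>
    ennreal (p 1 x y) = ennreal (gauss_density 0 1 (y - x)) * confinement N X c C y"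
proof -
  note [measurable] = confinement_measurable[OF X C(1,2)] borel_open[OF C(1)]
  have p: "continuous_on C (p 1 x)"
    "\<And>A. A \<in> sets borel \<Longrightarrow> A \<subseteq> C \<Longrightarrow>
      emeasure (Q x) {\<omega> \<in> space (Q x). W 1 \<omega> \<in> A \<and> ereal 1 < exit_time C (\<lambda>s. W s \<omega>)} =
      (\<integral>\<^sup>+ y\<in>A. ennreal (p 1 x y) \<partial>lborel)"
    using kernel x unfolding killed_transition_density_def by auto
  let ?f = "\<lambda>y. ennreal (indicator C y * p 1 x y)"
  let ?h = "\<lambda>y. indicator C y * (ennreal (gauss_density 0 1 (y - x)) * confinement N X c C y)"
  have "(\<lambda>y. indicator C y *\<^sub>R p 1 x y) \<in> borel_measurable borel"
    by (rule borel_measurable_continuous_on_indicator[OF _ p(1)]) simp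
  then have f [measurable]: "?f \<in> borel_measurable borel" by simp
  have "AE y in lborel. ?f y = ?h y"
  proof (rule sigma_finite_measure.density_unique2[OF sigma_finite_lborel])
    fix A :: "(real ^ 'n) set" assume "A \<in> sets lborel"
    then have A: "A \<inter> C \<in> sets borel" "A \<inter> C \<subseteq> C" using C(1) by auto
    have "(\<integral>\<^sup>+y\<in>A. ?f y \<partial>lborel) = (\<integral>\<^sup>+y\<in>A \<inter> C. ennreal (p 1 x y) \<partial>lborel)"
      by (intro nn_integral_cong) (simp split: split_indicator)
    also have "\<dots> = emeasure (Q x) {\<omega> \<in> space (Q x). W 1 \<omega> \<in> A \<inter> C \<and> ereal 1 < exit_time C (\<lambda>s. W s \<omega>)}"
      by (rule p(2)[OF A, symmetric])
    also have "{\<omega> \<in> space (Q x). W 1 \<omega> \<in> A \<inter> C \<and> ereal 1 < exit_time C (\<lambda>s. W s \<omega>)} =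
        {\<omega> \<in> space (Q x). (\<forall>s\<in>{0<..1}. W s \<omega> \<in> C) \<and> W 1 \<omega> \<in> A \<inter> C}"
      using less_exit_time_iff[OF C(1) brownian_motionD(3)[OF W] zero_less_one] by auto
    also have "emeasure (Q x) \<dots> = (\<integral>\<^sup>+y\<in>A \<inter> C. ennreal (gauss_density (1 *\<^sub>R 0) 1 (y - x)) * confinement N X c C (y /\<^sub>R 1) \<partial>lborel)"
      by (rule confined_until_decomposition[OF W X zero_less_one C A])
    also have "\<dots> = (\<integral>\<^sup>+y\<in>A. ?h y \<partial>lborel)"
      by (intro nn_integral_cong) (simp split: split_indicator)
    finally show "(\<integral>\<^sup>+y\<in>A. ?f y \<partial>lborel) = (\<integral>\<^sup>+y\<in>A. ?h y \<partial>lborel)" .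
  qed simp_all
  then show ?thesis
    by eventually_elim auto
qed

lemma AE_lborel_sequence:
  fixes a :: "'a :: euclidean_space"
  assumes "AE y in lborel. y \<in> C \<longrightarrow> R y" "open C" "a \<in> C"
  obtains y where "y \<longlonglongrightarrow> a" "\<And>n :: nat. y n \<in> C" "\<And>n. R (y n)"
proof -
  obtain Z where Z: "{y. \<not> (y \<in> C \<longrightarrow> R y)} \<subseteq> Z" "emeasure lborel Z = 0" "Z \<in> sets lborel"
    using assms(1) by (auto elim!: AE_E)
  have "\<exists>y. y \<in> C \<and> R y \<and> dist y a < 1 / (real n + 1)" for n
  proof (rule ccontr)
    assume "\<not> ?thesis"
    then have "C \<inter> ball a (1 / (real n + 1)) \<subseteq> Z" using Z(1) by (auto simp: dist_commute)
    then have "emeasure lborel (C \<inter> ball a (1 / (real n + 1))) \<le> emeasure lborel Z"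
      by (rule emeasure_mono) (use Z in simp)
    moreover have "a \<in> C \<inter> ball a (1 / (real n + 1))" using assms(3) by simp
    then have "emeasure lborel (C \<inter> ball a (1 / (real n + 1))) \<noteq> 0"
      using assms(2) by (intro open_emeasure_lborel_pos) auto
    ultimately show False using Z(2) by simp
  qed
  then obtain y where y: "\<And>n. y n \<in> C" "\<And>n. R (y n)" "\<And>n. dist (y n) a < 1 / (real n + 1)"
    by metis
  have "(\<lambda>n. dist (y n) a) \<longlonglongrightarrow> 0"
  proof (rule tendsto_sandwich[OF _ _ tendsto_const])
    show "(\<lambda>n. 1 / (real n + 1)) \<longlonglongrightarrow> 0" by real_asymp
    show "\<forall>\<^sub>F n in sequentially. dist (y n) a \<le> 1 / (real n + 1)"
      using y(3) by (auto intro: always_eventually less_imp_le)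
  qed simp
  then have "y \<longlonglongrightarrow> a" by (rule tendsto_dist_iff[THEN iffD2])
  then show ?thesis using that y by blast
qed

theorem theorem3:
  fixes C :: "(real ^ 'n) set" and a :: "real ^ 'n"
    and P :: "real ^ 'n \<Rightarrow> 'w measure" and B :: "real \<Rightarrow> 'w \<Rightarrow> real ^ 'n"
    and Q :: "real ^ 'n \<Rightarrow> 'v measure" and W :: "real \<Rightarrow> 'v \<Rightarrow> real ^ 'n"
    and p :: "real \<Rightarrow> real ^ 'n \<Rightarrow> real ^ 'n \<Rightarrow> real"
  assumes dim: "CARD('n) \<ge> 2"
    and cone: "normal_cone C"
    and drift_bm: "\<And>x. brownian_motion (P x) B x a"
    and standard_bm: "\<And>x. brownian_motion (Q x) W x 0"
    and kernel: "killed_transition_density Q W C p"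
    and a: "a \<in> C"
  shows "\<forall>x\<in>C.
     ((\<lambda>t :: real. measure (P x) {\<omega> \<in> space (P x). exit_time C (\<lambda>s. B s \<omega>) > ereal t})
        \<longlongrightarrow> measure (P x) {\<omega> \<in> space (P x). exit_time C (\<lambda>s. B s \<omega>) = \<infinity>}) at_top \<and>
     measure (P x) {\<omega> \<in> space (P x). exit_time C (\<lambda>s. B s \<omega>) = \<infinity>} =
       (2 * pi) powr (real CARD('n) / 2) * exp ((norm (x - a))\<^sup>2 / 2) * p 1 x a"
proof
  fix x assume x: "x \<in> C"
  have C: "open C" "C \<noteq> UNIV" "\<And>r z. 0 < r \<Longrightarrow> r *\<^sub>R z \<in> C \<longleftrightarrow> z \<in> C"
    using normal_cone_open[OF cone] zero_notin_normal_cone[OF cone] normal_cone_scaleR[OF cone] by auto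
  note X = drift_bm[of x]
  interpret prob_space "P x" by (rule brownian_motionD(1)[OF X])
  let ?E = "\<lambda>y. {\<omega> \<in> space (P x). \<forall>u>0. B u \<omega> + u *\<^sub>R (y - a) \<in> C}"
  let ?g = "\<lambda>y. gauss_density 0 1 (y - x)"
  have E: "?E y \<in> events" for y
    by (rule confined_event_measurable[OF brownian_motion_add_drift[OF X] C(1,2)])
  have conf: "confinement (P x) B a C y = ennreal (prob (?E y))" for y
    by (simp add: confinement_def emeasure_eq_measure)
  have exit: "emeasure (P x) {\<omega> \<in> space (P x). \<not> (\<forall>u>0. B u \<omega> + u *\<^sub>R (y - a) \<in> C)} = ennreal (1 - prob (?E y))" for y
  proof -
    have "{\<omega> \<in> space (P x). \<not> (\<forall>u>0. B u \<omega> + u *\<^sub>R (y - a) \<in> C)} = space (P x) - ?E y" by auto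
    then show ?thesis using prob_compl[OF E[of y]] by (simp only: emeasure_eq_measure)
  qed
  have p: "continuous_on C (p 1 x)" "\<And>y. y \<in> C \<Longrightarrow> 0 \<le> p 1 x y"
    using kernel x unfolding killed_transition_density_def by auto
  obtain y where y: "y \<longlonglongrightarrow> a" "\<And>n. y n \<in> C"
    "\<And>n. ennreal (p 1 x (y n)) = ennreal (?g (y n)) * confinement (P x) B a C (y n)"
    using AE_lborel_sequence[OF killed_density_eq_confinement_AE[OF standard_bm[of x] kernel X x C] C(1) a] by metis
  have g: "0 < ?g y" for y by (rule gauss_density_pos) simp
  have eq: "prob (?E (y n)) = p 1 x (y n) / ?g (y n)" for n
  proof -
    have "ennreal (p 1 x (y n)) = ennreal (?g (y n) * prob (?E (y n)))"
      using y(3)[of n] g by (simp add: conf ennreal_mult less_imp_le)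
    then have "p 1 x (y n) = ?g (y n) * prob (?E (y n))"
      using p(2)[OF y(2)] g by (subst (asm) ennreal_inj) (simp_all add: gauss_density_nonneg)
    then show ?thesis using g[of "y n"] by simp
  qed
  let ?L = "p 1 x a / ?g a"
  have "(\<lambda>n. p 1 x (y n)) \<longlonglongrightarrow> p 1 x a"
    by (rule continuous_on_tendsto_compose[OF p(1) y(1) a]) (simp add: y(2))
  moreover have "(\<lambda>n. ?g (y n)) \<longlonglongrightarrow> ?g a"
    unfolding gauss_density_def using y(1) by (intro tendsto_intros) auto
  ultimately have lim: "(\<lambda>n. prob (?E (y n))) \<longlonglongrightarrow> ?L"
    unfolding eq using g[of a] by (intro tendsto_divide) auto
  then have L: "0 \<le> ?L" "?L \<le> 1"
    by (auto intro: LIMSEQ_le_const LIMSEQ_le_const2)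
  \<comment> \<open>Both the probability of staying and that of leaving are lower semicontinuous in the drift, which
    pins the value at \<open>a\<close> to the limit \<open>?L\<close>.\<close>
  have "ennreal (prob (?E a)) \<le> liminf (\<lambda>n. ennreal (prob (?E (y n))))"
    using confinement_lsc[OF X x C a y(1)] by (simp only: conf)
  also have "\<dots> = ennreal ?L"
    by (intro lim_imp_Liminf tendsto_ennrealI lim) simp
  finally have upper: "prob (?E a) \<le> ?L" using L by simp
  have "ennreal (1 - prob (?E a)) \<le> liminf (\<lambda>n. ennreal (1 - prob (?E (y n))))"
    using exit_lsc[OF X C y(1)] by (simp only: exit)
  also have "\<dots> = ennreal (1 - ?L)"
    by (intro lim_imp_Liminf tendsto_ennrealI tendsto_diff tendsto_const lim) simp
  finally have lower: "?L \<le> prob (?E a)" using L by simp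
  have "prob {\<omega> \<in> space (P x). exit_time C (\<lambda>s. B s \<omega>) = \<infinity>} = ?L"
    using upper lower by (simp add: exit_time_eq_infinity_iff)
  also have "\<dots> = (2 * pi) powr (real CARD('n) / 2) * exp ((norm (x - a))\<^sup>2 / 2) * p 1 x a"
    by (simp add: gauss_density_def exp_minus norm_minus_commute field_simps)
  finally show "((\<lambda>t :: real. prob {\<omega> \<in> space (P x). exit_time C (\<lambda>s. B s \<omega>) > ereal t})
        \<longlongrightarrow> prob {\<omega> \<in> space (P x). exit_time C (\<lambda>s. B s \<omega>) = \<infinity>}) at_top \<and>
     prob {\<omega> \<in> space (P x). exit_time C (\<lambda>s. B s \<omega>) = \<infinity>} =
       (2 * pi) powr (real CARD('n) / 2) * exp ((norm (x - a))\<^sup>2 / 2) * p 1 x a"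
    using survival_tendsto[OF X C(1,2)] by simp
qed

end
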